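(* Let $\mathbb{K}$ be a field of characteristic zero, $q\in\mathbb{K}\setminus\{0\}$ not a root of unity, and $\tau_x,\tau_y$ the $q$-shift operators on $\mathbb{K}(x,y)$ given by $\tau_x h(x,y)=h(qx,y)$ and $\tau_y h(x,y)=h(x,qy)$. Let $j$ be a positive integer, $d\in\mathbb{K}[x,y]\setminus\{y\}$ irreducible, and $a\in\mathbb{K}(x)[y]\setminus\{0\}$ with $\deg_y(a)<\deg_y(d)$. Then $a/d^j$ is $(\tau_x,\tau_y)$-summable if and only if both of the following hold: (1) there exist integers $t,\ell,v$ with $t\neq 0$ such that $\tau_x^{t}(d)=q^{v}\tau_y^{\ell}(d)$; (2) for the smallest positive integer $t$ for which integers $\ell,v$ with $\tau_x^{t}(d)=q^{v}\tau_y^{\ell}(d)$ exist, and such corresponding integers $\ell,v$, there exists $p\in\mathbb{K}(x)[y]$ with $\deg_y(p)<\deg_y(d)$ such that \[ a=q^{-vj}\tau_x^{t}\tau_y^{-\ell}(p)-p. \]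
   Context: A rational function $f\in\mathbb{K}(x,y)$ is $(\tau_x,\tau_y)$-summable if $f=\tau_x g-g+\tau_y h-h$ for some $g,h\in\mathbb{K}(x,y)$.
   Formalization: The formal statement excludes every d = cy with c in K, not only d = y; the claim as written fails for d = 2y, j = 1, a = 1/(x−1), where a/d is summable but no p as in (2) exists. *)

theory Defs
  imports "HOL-Computational_Algebra.Computational_Algebra"
begin

text \<open>
  For a field \<open>K\<close> of type \<open>'a\<close>, the polynomial ring \<open>K[x,y]\<close> is \<open>'a poly poly\<close>, whose outer
  variable is \<open>y\<close>, so that \<open>y = [:0, 1:]\<close> and \<open>x = [:[:0, 1:]:]\<close>; \<open>K(x)[y]\<close> is
  \<open>'a poly fract poly\<close>, and \<open>K(x,y)\<close> is its fraction field \<open>'a poly fract poly fract\<close>.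
  In \<open>K[x,y]\<close> and in \<open>K(x)[y]\<close>, \<^const>\<open>degree\<close> is the degree in \<open>y\<close>.
\<close>

type_synonym 'a ratfun = "'a poly fract poly fract"

definition const_ratfun :: "'a::field \<Rightarrow> 'a ratfun" where
  "const_ratfun c = to_fract [:to_fract [:c:]:]"

definition poly_ratfun :: "'a::field poly poly \<Rightarrow> 'a ratfun" where
  "poly_ratfun p = to_fract (fract_poly p)"

text \<open>
  The choice of the representative is immaterial whenever \<open>\<phi>\<close> is multiplicative and vanishes only
  at \<open>0\<close>, see \<open>map_fract_Fract\<close>.
\<close>

definition map_fract :: "('a::idom \<Rightarrow> 'b::idom) \<Rightarrow> 'a fract \<Rightarrow> 'b fract" where
  "map_fract \<phi> r = (let (a, b) = (SOME (a, b). b \<noteq> 0 \<and> r = Fract a b) in Fract (\<phi> a) (\<phi> b))"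

definition tau_x :: "'a::field \<Rightarrow> 'a ratfun \<Rightarrow> 'a ratfun" where
  "tau_x q = map_fract (map_poly (map_fract (\<lambda>u. u \<circ>\<^sub>p [:0, q:])))"

definition tau_y :: "'a::field \<Rightarrow> 'a ratfun \<Rightarrow> 'a ratfun" where
  "tau_y q = map_fract (\<lambda>u. u \<circ>\<^sub>p [:0, to_fract [:q:]:])"

text \<open>Integer powers of a bijection under composition.\<close>

definition funpow_int :: "('b \<Rightarrow> 'b) \<Rightarrow> int \<Rightarrow> 'b \<Rightarrow> 'b" where
  "funpow_int f k = (if 0 \<le> k then f ^^ nat k else inv f ^^ nat (- k))"

definition tau_summable :: "'a::field \<Rightarrow> 'a ratfun \<Rightarrow> bool" where
  "tau_summable q f \<longleftrightarrow> (\<exists>g h. f = tau_x q g - g + (tau_y q h - h))"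

definition shift_related :: "'a::field \<Rightarrow> 'a poly poly \<Rightarrow> int \<Rightarrow> int \<Rightarrow> int \<Rightarrow> bool" where
  "shift_related q d t l v \<longleftrightarrow>
     funpow_int (tau_x q) t (poly_ratfun d)
       = const_ratfun (q powi v) * funpow_int (tau_y q) l (poly_ratfun d)"

text \<open>
  The remaining facts confirm that the operators are well defined, that they are the substitutions
  \<open>x \<mapsto> q x\<close> and \<open>y \<mapsto> q y\<close>, and that they are bijective for \<open>q \<noteq> 0\<close>.
\<close>

lemma map_fract_Fract:
  assumes mult: "\<And>a b. \<phi> (a * b) = \<phi> a * \<phi> b" and zero: "\<And>a. \<phi> a = 0 \<longleftrightarrow> a = 0"
    and b: "b \<noteq> 0"
  shows "map_fract \<phi> (Fract a b) = Fract (\<phi> a) (\<phi> b)"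
proof -
  let ?P = "\<lambda>(c, e). e \<noteq> 0 \<and> Fract a b = Fract c e"
  obtain c e where ce: "(SOME p. ?P p) = (c, e)"
    by (cases "SOME p. ?P p") auto
  have "?P (SOME p. ?P p)"
    by (rule someI[of ?P "(a, b)"]) (use b in auto)
  then have e: "e \<noteq> 0" and "Fract a b = Fract c e"
    unfolding ce by auto
  with b have "a * e = c * b"
    by (simp add: eq_fract)
  then have "\<phi> a * \<phi> e = \<phi> c * \<phi> b"
    by (metis mult)
  then have "Fract (\<phi> c) (\<phi> e) = Fract (\<phi> a) (\<phi> b)"
    using b e zero by (simp add: eq_fract)
  then show ?thesis
    by (simp add: map_fract_def ce)
qed

lemma map_fract_zero_iff:
  assumes "\<And>a b. \<phi> (a * b) = \<phi> a * \<phi> b" "\<And>a. \<phi> a = 0 \<longleftrightarrow> a = 0"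
  shows "map_fract \<phi> r = 0 \<longleftrightarrow> r = 0"
proof (cases r)
  case (Fract a b)
  then show ?thesis
    using assms by (simp add: map_fract_Fract Zero_fract_def eq_fract)
qed

lemma map_fract_mult:
  assumes "\<And>a b. \<phi> (a * b) = \<phi> a * \<phi> b" "\<And>a. \<phi> a = 0 \<longleftrightarrow> a = 0"
  shows "map_fract \<phi> (r * s) = map_fract \<phi> r * map_fract \<phi> s"
proof (cases r; cases s)
  fix a b c e
  assume "r = Fract a b" "b \<noteq> 0" "s = Fract c e" "e \<noteq> 0"
  then show ?thesis
    using assms by (simp add: map_fract_Fract)
qed

lemma map_fract_add:
  assumes "\<And>a b. \<phi> (a * b) = \<phi> a * \<phi> b" "\<And>a. \<phi> a = 0 \<longleftrightarrow> a = 0"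
    and "\<And>a b. \<phi> (a + b) = \<phi> a + \<phi> b"
  shows "map_fract \<phi> (r + s) = map_fract \<phi> r + map_fract \<phi> s"
proof (cases r; cases s)
  fix a b c e
  assume "r = Fract a b" "b \<noteq> 0" "s = Fract c e" "e \<noteq> 0"
  then show ?thesis
    using assms by (simp add: map_fract_Fract)
qed

lemma map_poly_hom_mult:
  fixes \<phi> :: "'a::comm_ring_1 \<Rightarrow> 'b::comm_ring_1"
  assumes mult: "\<And>a b. \<phi> (a * b) = \<phi> a * \<phi> b" and add: "\<And>a b. \<phi> (a + b) = \<phi> a + \<phi> b"
    and zero: "\<phi> 0 = 0"
  shows "map_poly \<phi> (u * w) = map_poly \<phi> u * map_poly \<phi> w"
proof -
  have "\<phi> (sum g A) = (\<Sum>i\<in>A. \<phi> (g i))" for g and A :: "nat set"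
    by (induction A rule: infinite_finite_induct) (simp_all add: add zero)
  then show ?thesis
    by (intro poly_eqI) (simp add: coeff_map_poly zero coeff_mult mult)
qed

lemma pcompose_scale_zero_iff:
  "c \<noteq> 0 \<Longrightarrow> u \<circ>\<^sub>p [:0, c:] = 0 \<longleftrightarrow> u = 0" for c :: "'a::idom"
  by (simp add: pcompose_eq_0_iff)

lemmas map_fract_scale = map_fract_Fract[OF pcompose_mult pcompose_scale_zero_iff]

lemma map_poly_map_fract_scale:
  fixes q :: "'a::field"
  assumes "q \<noteq> 0"
  defines "\<phi> \<equiv> map_poly (map_fract (\<lambda>u. u \<circ>\<^sub>p [:0, q:]))"
  shows "\<phi> (u * w) = \<phi> u * \<phi> w" and "\<phi> u = 0 \<longleftrightarrow> u = 0"
  unfolding \<phi>_def using assms(1)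
  by (auto intro!: map_poly_hom_mult map_fract_mult map_fract_add
      simp: map_fract_zero_iff pcompose_mult pcompose_add pcompose_scale_zero_iff map_poly_eq_0_iff)

lemma tau_x_Fract:
  assumes "q \<noteq> 0" "w \<noteq> 0"
  shows "tau_x q (Fract u w) = Fract (map_poly (map_fract (\<lambda>u. u \<circ>\<^sub>p [:0, q:])) u)
                                     (map_poly (map_fract (\<lambda>u. u \<circ>\<^sub>p [:0, q:])) w)"
  unfolding tau_x_def
  by (rule map_fract_Fract) (use assms in \<open>simp_all add: map_poly_map_fract_scale\<close>)

lemma tau_y_Fract:
  assumes "q \<noteq> 0" "w \<noteq> 0"
  shows "tau_y q (Fract u w) = Fract (u \<circ>\<^sub>p [:0, to_fract [:q:]:]) (w \<circ>\<^sub>p [:0, to_fract [:q:]:])"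
  unfolding tau_y_def by (rule map_fract_scale) (use assms in simp_all)

lemma pcompose_scale_scale:
  "c * e = 1 \<Longrightarrow> u \<circ>\<^sub>p [:0, c:] \<circ>\<^sub>p [:0, e:] = u" for c :: "'a::idom"
  by (simp flip: pcompose_assoc add: pcompose_pCons mult.commute)

lemma bij_tau_y:
  assumes "q \<noteq> 0"
  shows "bij (tau_y q)"
proof -
  have "tau_y e (tau_y c r) = r" if "c * e = 1" for c e :: 'a and r
  proof (cases r)
    case (Fract u w)
    have 0: "c \<noteq> 0" "e \<noteq> 0" and 1: "to_fract [:c:] * to_fract [:e:] = 1"
      using that by (auto simp flip: to_fract_mult simp: one_pCons[symmetric] mult.commute)
    with Fract show ?thesis
      by (simp add: tau_y_Fract pcompose_scale_zero_iff pcompose_scale_scale)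
  qed
  from this[of q "inverse q"] this[of "inverse q" q] assms show ?thesis
    by (intro o_bij[of "tau_y (inverse q)"]) (auto simp: fun_eq_iff)
qed

lemma bij_tau_x:
  assumes "q \<noteq> 0"
  shows "bij (tau_x q)"
proof -
  define \<phi> where "\<phi> c = map_fract (\<lambda>u. u \<circ>\<^sub>p [:0, c:])" for c :: 'a
  have "tau_x e (tau_x c r) = r" if "c * e = 1" for c e :: 'a and r
  proof (cases r)
    case (Fract u w)
    have 0: "c \<noteq> 0" "e \<noteq> 0"
      using that by auto
    have 1: "\<phi> e (\<phi> c s) = s" for s
      using that 0 unfolding \<phi>_def
      by (cases s) (simp add: map_fract_scale pcompose_scale_zero_iff pcompose_scale_scale)
    have "\<phi> e 0 = 0" "\<phi> c 0 = 0"
      using 0 by (simp_all add: \<phi>_def map_fract_zero_iff pcompose_mult pcompose_scale_zero_iff)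
    then have "map_poly (\<phi> e) (map_poly (\<phi> c) s) = s" for s
      using 1 by (intro poly_eqI) (simp add: coeff_map_poly)
    with Fract 0 show ?thesis
      by (simp add: tau_x_Fract map_poly_map_fract_scale \<phi>_def)
  qed
  from this[of q "inverse q"] this[of "inverse q" q] assms show ?thesis
    by (intro o_bij[of "tau_x (inverse q)"]) (auto simp: fun_eq_iff)
qed

end

theory Submission
  imports Defs "HOL-Library.Groups_Big_Fun"
begin

text \<open>
  Let \<open>D\<close> be \<open>d\<close> viewed in \<open>K(x)[y]\<close>, and let \<open>\<pi>\<close> take the numerator of \<open>1/D\<^sup>j\<close> in the partial
  fraction expansion with respect to \<open>y\<close>. A \<open>\<tau>\<^sub>y\<close>-invariant version of \<open>\<pi>\<close> is \<open>\<psi>(g) = \<Sum>k\<in>\<int>. \<pi>(\<tau>\<^sub>y\<^sup>k g)\<close>,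
  a finite sum because the \<open>\<tau>\<^sub>y\<close>-shifts of \<open>d\<close> are pairwise non-associated. Put \<open>u\<^sub>i = \<psi>(\<tau>\<^sub>x\<^sup>i g)\<close>. If
  \<open>f = a/d\<^sup>j = \<tau>\<^sub>x g - g + \<tau>\<^sub>y h - h\<close>, then the difference of \<open>u\<close> at \<open>i + 1\<close> and \<open>i\<close> is \<open>\<psi>(\<tau>\<^sub>x\<^sup>i f)\<close>,
  which is \<open>a\<close> for \<open>i = 0\<close> and vanishes unless \<open>\<tau>\<^sub>x\<^sup>i d\<close> is associated to some \<open>\<tau>\<^sub>y\<close>-shift of \<open>d\<close>. If
  this happens only for \<open>i = 0\<close>, then \<open>u\<close> is finitely supported and constant on either side of the
  jump \<open>a\<close>, so \<open>a = 0\<close>. Otherwise, for the minimal \<open>t\<close>, telescoping gives \<open>a = u\<^sub>t - u\<^sub>0\<close>, and \<open>u\<^sub>t\<close> is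
  the twisted shift of \<open>p = u\<^sub>0\<close>. The converse follows from \<open>a/d\<^sup>j = T(p/d\<^sup>j) - p/d\<^sup>j\<close> with
  \<open>T = \<tau>\<^sub>x\<^sup>t \<tau>\<^sub>y\<^sup>-\<^sup>l\<close>, as every such difference telescopes in both directions.
\<close>

section \<open>Digits with respect to an irreducible polynomial\<close>

lemma to_fract_power: "to_fract (x ^ n) = to_fract x ^ n"
  by (induction n) simp_all

lemma field_poly_degree_irreducible:
  fixes D :: "'k::field poly"
  assumes "irreducible D"
  shows "0 < degree D"
proof -
  have "D \<noteq> 0"
    using assms by (auto simp: irreducible_def)
  then show ?thesis
    using irreducible_not_unit[OF assms] is_unit_iff_degree by blast
qed

text \<open>A nonzero combination of \<open>B\<close> and \<open>D\<close> of least degree divides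
  both, hence is a unit. Multiplying a relation for \<open>D ^ m\<close> by one for \<open>D\<close>
  yields one for \<open>D ^ Suc m\<close>.\<close>

lemma field_poly_bezout_power:
  fixes D B :: "'k::field poly"
  assumes "irreducible D" "\<not> D dvd B"
  obtains u w where "u * B + w * D ^ m = 1"
proof -
  define I where "I = {g. g \<noteq> 0 \<and> (\<exists>u w. g = u * B + w * D)}"
  have "D \<noteq> 0"
    using assms by auto
  moreover have "D = 0 * B + 1 * D"
    by simp
  ultimately have "D \<in> I"
    unfolding I_def by blast
  define g where "g = arg_min degree (\<lambda>g. g \<in> I)"
  have gI: "g \<in> I" and g_le: "degree g \<le> degree h" if "h \<in> I" for h
    using arg_min_nat_lemma[of "\<lambda>g. g \<in> I" D degree] \<open>D \<in> I\<close> that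
    by (auto simp: g_def)
  note gI = gI[OF \<open>D \<in> I\<close>]
  then obtain u w where g: "g \<noteq> 0" "g = u * B + w * D"
    unfolding I_def by auto
  have dvd: "g dvd h" if h: "h = u' * B + w' * D" for h u' w'
  proof (rule ccontr)
    assume "\<not> g dvd h"
    then have nz: "h mod g \<noteq> 0"
      by (auto simp: dvd_eq_mod_eq_0)
    have "h mod g = h - h div g * g"
      by (simp add: minus_div_mult_eq_mod)
    also have "\<dots> = (u' - h div g * u) * B + (w' - h div g * w) * D"
      by (subst (2) g(2)) (simp add: h algebra_simps)
    finally have "h mod g \<in> I"
      using nz unfolding I_def by blast
    from g_le[OF this] degree_mod_less'[OF g(1) nz] show False
      by simp
  qed
  have "g dvd D" "g dvd B"
    using dvd[of D 0 1] dvd[of B 1 0] by simp_all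
  \<comment> \<open>Otherwise \<open>g\<close>, a divisor of the irreducible \<open>D\<close>, would
    be a multiple of \<open>D\<close>, and \<open>D\<close> would divide \<open>B\<close>.\<close>
  with assms have "g dvd 1"
    by (metis irreducibleD' dvd_trans)
  then obtain s where s: "1 = g * s" by (rule dvdE)
  have "(s * u) * B + (s * w) * D = s * (u * B + w * D)"
    by (simp add: algebra_simps)
  also have "\<dots> = 1"
    using s g(2) by (simp add: mult.commute)
  finally have base: "(s * u) * B + (s * w) * D = 1" .
  have "\<exists>u w. u * B + w * D ^ m = 1"
  proof (induction m)
    case 0
    show ?case by (rule exI[of _ 0], rule exI[of _ 1]) simp
  next
    case (Suc m)
    then obtain u' w' where 1: "u' * B + w' * D ^ m = 1" by blast
    have "1 = (u' * B + w' * D ^ m) * ((s * u) * B + (s * w) * D)"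
      unfolding 1 base by simp
    also have "\<dots> = (u' * ((s * u) * B + (s * w) * D) + w' * D ^ m * s * u) * B
        + (w' * s * w) * D ^ Suc m"
      by (simp add: algebra_simps)
    finally show ?case by metis
  qed
  then show thesis using that by blast
qed

lemma field_poly_split_power:
  fixes D C :: "'k::field poly"
  assumes "irreducible D" "C \<noteq> 0"
  obtains n B where "C = D ^ n * B" "\<not> D dvd B"
proof -
  have "\<exists>n B. C = D ^ n * B \<and> \<not> D dvd B"
    using \<open>C \<noteq> 0\<close>
  proof (induction "degree C" arbitrary: C rule: less_induct)
    case less
    show ?case
    proof (cases "D dvd C")
      case False
      then show ?thesis by (intro exI[of _ 0] exI[of _ C]) simp
    next
      case True
      then obtain C' where C': "C = D * C'" by (rule dvdE)
      with less.prems have nz: "D \<noteq> 0" "C' \<noteq> 0" by auto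
      then have "degree C' < degree C"
        using field_poly_degree_irreducible[OF assms(1)] by (simp add: C' degree_mult_eq)
      from less.hyps[OF this nz(2)] obtain n B where "C' = D ^ n * B" "\<not> D dvd B"
        by blast
      then show ?thesis
        by (intro exI[of _ "Suc n"] exI[of _ B]) (simp add: C')
    qed
  qed
  then show thesis using that by blast
qed

text \<open>By primality, the product of finitely many of these pairwise non-associated divisors
  divides \<open>B\<close>. Each factor has positive degree, so there are at most
  \<open>degree B\<close> of them. The third conjunct of the induction sends a new divisor to the
  cofactor.\<close>

lemma finite_irreducible_divisors:
  fixes P :: "'i \<Rightarrow> 'k::field poly"
  assumes "B \<noteq> 0" and "\<And>s. s \<in> S \<Longrightarrow> irreducible (P s)" "\<And>s. s \<in> S \<Longrightarrow> P s dvd B"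
    and inj: "\<And>s s'. s \<in> S \<Longrightarrow> s' \<in> S \<Longrightarrow> P s dvd P s' \<Longrightarrow> s = s'"
  shows "finite S"
proof -
  have "(\<Prod>s\<in>A. P s) dvd B \<and> card A \<le> degree (\<Prod>s\<in>A. P s) \<and>
      (\<forall>s\<in>S - A. \<not> P s dvd (\<Prod>s\<in>A. P s))" if "finite A" "A \<subseteq> S" for A
    using that
  proof (induction A)
    case empty
    then show ?case
      using assms(2) irreducible_not_unit by auto
  next
    case (insert s A)
    then have s: "s \<in> S" and A: "A \<subseteq> S" by auto
    have p: "prime_elem (P s)"
      using assms(2)[OF s] by (rule field_poly_irreducible_imp_prime)
    from insert A obtain C where C: "B = (\<Prod>s\<in>A. P s) * C" by blast
    have "\<not> P s dvd (\<Prod>s\<in>A. P s)"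
      using insert s by auto
    then have "P s dvd C"
      using C assms(3)[OF s] p by (metis prime_elem_dvd_mult_iff)
    then have 1: "(\<Prod>s\<in>insert s A. P s) dvd B"
      using insert by (simp add: C mult.commute mult_dvd_mono)
    then have "(\<Prod>s\<in>insert s A. P s) \<noteq> 0"
      using \<open>B \<noteq> 0\<close> by auto
    moreover have "degree (P s) > 0"
      using assms(2)[OF s] by (rule field_poly_degree_irreducible)
    moreover have "\<not> P s' dvd P s * (\<Prod>s\<in>A. P s)" if s': "s' \<in> S - insert s A" for s'
      using field_poly_irreducible_imp_prime[OF assms(2)[of s']] insert s' inj[of s' s] s
      by (auto simp: prime_elem_dvd_mult_iff)
    ultimately show ?case
      using 1 insert A by (simp add: degree_mult_eq)
  qed
  then have "card A \<le> degree B" if "finite A" "A \<subseteq> S" for A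
    using dvd_imp_degree_le[OF _ \<open>B \<noteq> 0\<close>] that by (meson le_trans)
  then show ?thesis
    by (meson finite_if_finite_subsets_card_bdd)
qed

text \<open>
  \<open>e\<close> is the coefficient of \<open>D\<^sup>0\<close> in the \<open>D\<close>-adic expansion of \<open>z\<close>: the term \<open>E / D\<^sup>n\<close> collects the
  negative powers of \<open>D\<close>, and \<open>D N / B\<close> lies in the maximal ideal of the local ring at \<open>D\<close>.
\<close>

definition is_digit :: "'k::field poly \<Rightarrow> 'k poly fract \<Rightarrow> 'k poly \<Rightarrow> bool" where
  "is_digit D z e \<longleftrightarrow> degree e < degree D \<and>
     (\<exists>n E N B. degree E < n * degree D \<and> \<not> D dvd B \<and>
        z = to_fract e + to_fract E / to_fract (D ^ n) + to_fract (D * N) / to_fract B)"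

lemma is_digitI:
  assumes "degree e < degree D" "degree E < n * degree D" "\<not> D dvd B"
    and "z = to_fract e + to_fract E / to_fract (D ^ n) + to_fract (D * N) / to_fract B"
  shows "is_digit D z e"
  using assms unfolding is_digit_def by blast

text \<open>Put \<open>z\<close> over \<open>D ^ n * B\<close> with \<open>B\<close> prime to
  \<open>D\<close>. A Bezout relation splits this into a fraction over \<open>D ^ n\<close> and one
  over \<open>B\<close>. Dividing the first numerator by \<open>D ^ n\<close> and the quotient by
  \<open>D\<close> leaves the remainders \<open>E\<close> and \<open>e\<close>; the rest goes into
  \<open>N\<close>.\<close>

lemma is_digit_exists:
  assumes D: "irreducible D"
  shows "\<exists>e. is_digit D z e"
proof (cases z)
  case (Fract A C)
  have D0: "D \<noteq> 0" and degD: "degree D > 0"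
    using field_poly_degree_irreducible[OF D] by auto
  obtain m B where C: "C = D ^ m * B" and B: "\<not> D dvd B"
    using field_poly_split_power[OF D Fract(2)] .
  have B0: "B \<noteq> 0" using B by auto
  \<comment> \<open>The fraction is expanded by \<open>D\<close> so that \<open>n > 0\<close>: for
    \<open>n = 0\<close> the strict bound on \<open>degree E\<close> fails even if
    \<open>E = 0\<close>.\<close>
  define n where "n = Suc m"
  define A' where "A' = A * D"
  \<comment> \<open>The exponent \<open>Suc n\<close> instead of \<open>n\<close> leaves a factor
    \<open>D\<close> in the numerator over \<open>B\<close> after \<open>D ^ n\<close> is
    cancelled.\<close>
  obtain u w where bez: "u * B + w * D ^ Suc n = 1"
    using field_poly_bezout_power[OF D B] .
  define R where "R = (A' * u) div D ^ n"
  define E where "E = (A' * u) mod D ^ n"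
  define Q where "Q = R div D"
  define e where "e = R mod D"
  have split: "A' * u = (Q * D + e) * D ^ n + E"
    by (simp only: R_def E_def Q_def e_def div_mult_mod_eq)
  have z: "z = to_fract A' / (to_fract (D ^ n) * to_fract B)"
    using Fract D0 B0 by (simp add: Fract_conv_to_fract C A'_def n_def field_simps)
  have "to_fract A' = to_fract A' * to_fract (u * B + w * D ^ Suc n)"
    by (simp only: bez to_fract_1 mult_1_right)
  also have "\<dots> = to_fract (A' * u) * to_fract B + to_fract (A' * w * D ^ Suc n)"
    by (simp add: algebra_simps)
  finally have "z = to_fract (A' * u) / to_fract (D ^ n) + to_fract (D * (A' * w)) / to_fract B"
    using D0 B0 by (simp add: z field_simps)
  also have "\<dots> = to_fract e + to_fract E / to_fract (D ^ n)
      + to_fract (D * (A' * w + Q * B)) / to_fract B"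
    using D0 B0 unfolding split by (simp add: field_simps)
  finally have z': "z = \<dots>" .
  have "degree e < degree D"
    using degD D0 degree_mod_less'[of D R] by (cases "e = 0") (auto simp: e_def)
  moreover have "degree E < n * degree D"
    using degD D0 degree_mod_less'[of "D ^ n" "A' * u"]
    by (cases "E = 0") (auto simp: E_def n_def degree_power_eq simp flip: power_Suc)
  ultimately show ?thesis
    using is_digitI[OF _ _ B z'] by blast
qed

text \<open>Common denominators are \<open>D ^ (n + n')\<close> and \<open>B * B'\<close>; the
  latter stays prime to \<open>D\<close> because \<open>D\<close> is a prime element. Both
  uniqueness and additivity of the digit rest on this.\<close>

lemma is_digit_diff:
  assumes D: "irreducible D" and 1: "is_digit D z e" and 2: "is_digit D z' e'"
  shows "is_digit D (z - z') (e - e')"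
proof -
  from 1 obtain n E N B where *: "degree e < degree D" "degree E < n * degree D" "\<not> D dvd B"
    "z = to_fract e + to_fract E / to_fract (D ^ n) + to_fract (D * N) / to_fract B"
    unfolding is_digit_def by blast
  from 2 obtain n' E' N' B' where **: "degree e' < degree D" "degree E' < n' * degree D" "\<not> D dvd B'"
    "z' = to_fract e' + to_fract E' / to_fract (D ^ n') + to_fract (D * N') / to_fract B'"
    unfolding is_digit_def by blast
  have D0: "D \<noteq> 0" "B \<noteq> 0" "B' \<noteq> 0" using D * ** by auto
  have "degree (E * D ^ n') < (n + n') * degree D" "degree (E' * D ^ n) < (n + n') * degree D"
    using *(2) **(2) degree_mult_le[of E "D ^ n'"] degree_mult_le[of E' "D ^ n"]
    by (simp_all add: degree_power_eq D0 algebra_simps)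
  moreover have "\<not> D dvd B * B'"
    using *(3) **(3) field_poly_irreducible_imp_prime[OF D] by (simp add: prime_elem_dvd_mult_iff)
  moreover have "z - z' = to_fract (e - e')
      + to_fract (E * D ^ n' - E' * D ^ n) / to_fract (D ^ (n + n'))
      + to_fract (D * (N * B' - N' * B)) / to_fract (B * B')"
    using D0 by (simp add: *(4) **(4) field_simps power_add)
  ultimately show ?thesis
    using *(1) **(1) by (intro is_digitI[where E = "E * D ^ n' - E' * D ^ n" and N = "N * B' - N' * B"] degree_diff_less)
qed

text \<open>Clearing denominators shows that \<open>D ^ Suc n\<close> divides
  \<open>e * D ^ n + E\<close>, whose degree is too small, so this sum is 0. Then
  \<open>D ^ n\<close> divides \<open>E\<close>, and the degree bound again forces
  \<open>E = 0\<close>.\<close>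

lemma is_digit_zero:
  assumes D: "irreducible D" and "is_digit D 0 e"
  shows "e = 0"
proof -
  from assms(2) obtain n E N B where *: "degree e < degree D" "degree E < n * degree D" "\<not> D dvd B"
    "0 = to_fract e + to_fract E / to_fract (D ^ n) + to_fract (D * N) / to_fract B"
    unfolding is_digit_def by blast
  have D0: "D \<noteq> 0" "B \<noteq> 0" using D * by auto
  have "0 = (to_fract e + to_fract E / to_fract (D ^ n) + to_fract (D * N) / to_fract B)
      * (to_fract (D ^ n) * to_fract B)"
    using *(4) by simp
  also have "\<dots> = to_fract ((e * D ^ n + E) * B + N * D ^ Suc n)"
    using D0 by (simp add: field_simps)
  finally have "(e * D ^ n + E) * B + N * D ^ Suc n = 0"
    by (metis to_fract_eq_0_iff)
  then have eq: "(e * D ^ n + E) * B = - N * D ^ Suc n"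
    by (simp add: eq_neg_iff_add_eq_0)
  obtain u w where bez: "u * B + w * D ^ Suc n = 1"
    using field_poly_bezout_power[OF D *(3)] .
  have "e * D ^ n + E = (e * D ^ n + E) * (u * B + w * D ^ Suc n)"
    by (simp only: bez mult_1_right)
  also have "\<dots> = u * ((e * D ^ n + E) * B) + (e * D ^ n + E) * w * D ^ Suc n"
    by (simp add: algebra_simps)
  finally have "e * D ^ n + E = (- u * N + (e * D ^ n + E) * w) * D ^ Suc n"
    unfolding eq by (simp add: algebra_simps)
  then have "D ^ Suc n dvd e * D ^ n + E"
    by (metis dvd_triv_right)
  moreover have "degree (e * D ^ n + E) < degree (D ^ Suc n)"
    using *(1,2) degree_mult_le[of e "D ^ n"]
    by (intro degree_add_less) (auto simp: degree_power_eq D0 simp del: power_Suc)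
  ultimately have 0: "e * D ^ n + E = 0"
    by (meson dvd_imp_degree_le leD)
  then have "D ^ n dvd E"
    by (metis add_eq_0_iff dvd_minus_iff dvd_triv_right)
  then have "E = 0"
    using *(2) by (metis D0(1) degree_power_eq dvd_imp_degree_le leD)
  with 0 D0 show ?thesis by simp
qed

text \<open>The constant can be absorbed into \<open>E\<close> and \<open>N\<close>. The case arises
  because a shift that stabilizes \<open>D\<close> does so only up to a constant factor.\<close>

lemma is_digit_smult:
  fixes D :: "'k::field poly"
  assumes k: "k \<noteq> 0" and "is_digit (smult k D) z e"
  shows "is_digit D z e"
proof -
  from assms(2) obtain n E N B where *: "degree e < degree (smult k D)"
    "degree E < n * degree (smult k D)" "\<not> smult k D dvd B"
    "z = to_fract e + to_fract E / to_fract (smult k D ^ n) + to_fract (smult k D * N) / to_fract B"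
    unfolding is_digit_def by blast
  have sm: "to_fract (smult c p) = to_fract [:c:] * to_fract p" for c and p :: "'k poly"
    by (simp flip: to_fract_mult)
  have "to_fract [:inverse k ^ n:] * to_fract [:k ^ n:] = 1"
    using k by (simp add: power_inverse flip: to_fract_mult one_pCons)
  then have "to_fract E / to_fract (smult k D ^ n) = to_fract (smult (inverse k ^ n) E) / to_fract (D ^ n)"
    using k by (simp add: smult_power sm divide_simps)
  with * k show ?thesis
    by (intro is_digitI[where n = n and E = "smult (inverse k ^ n) E" and B = B and N = "smult k N"])
       (auto simp: smult_dvd_iff)
qed

section \<open>The digit as a linear function\<close>

definition digit :: "'k::field poly \<Rightarrow> 'k poly fract \<Rightarrow> 'k poly" where
  "digit D z = (THE e. is_digit D z e)"

lemma digit_eq: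
  assumes "irreducible D" "is_digit D z e"
  shows "digit D z = e"
  unfolding digit_def
proof (rule the_equality)
  fix e' assume "is_digit D z e'"
  with assms is_digit_diff[of D z e' z e] have "is_digit D 0 (e' - e)" by simp
  with assms show "e' = e" using is_digit_zero by fastforce
qed fact

lemma is_digit_digit: "irreducible D \<Longrightarrow> is_digit D z (digit D z)"
  using is_digit_exists digit_eq by metis

lemma digit_diff: "irreducible D \<Longrightarrow> digit D (z - z') = digit D z - digit D z'"
  by (intro digit_eq is_digit_diff is_digit_digit)

lemma digit_zero [simp]: "irreducible D \<Longrightarrow> digit D 0 = 0"
  using digit_diff[of D 0 0] by simp

lemma digit_add: "irreducible D \<Longrightarrow> digit D (z + z') = digit D z + digit D z'"
  using digit_diff[of D z "- z'"] digit_diff[of D 0 z'] by simp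

lemma degree_digit: "irreducible D \<Longrightarrow> degree (digit D z) < degree D"
  using is_digit_digit is_digit_def by blast

lemma digit_to_fract:
  assumes "irreducible D" "degree e < degree D"
  shows "digit D (to_fract e) = e"
proof (rule digit_eq[OF assms(1)], rule is_digitI[where n = 1 and E = 0 and B = 1 and N = 0])
  show "\<not> D dvd 1" using assms(1) by (rule irreducible_not_unit)
qed (use assms(2) in auto)

text \<open>The fraction lies in the maximal ideal of the local ring at \<open>D\<close>, so the
  last term of the expansion is all of it.\<close>

lemma digit_eq_0:
  assumes "irreducible D" "\<not> D dvd B"
  shows "digit D (to_fract (D * N) / to_fract B) = 0"
proof (rule digit_eq[OF assms(1)], rule is_digitI[where n = 1 and E = 0 and B = B and N = N])
  from field_poly_degree_irreducible[OF assms(1)] show "degree (0 :: 'a poly) < degree D" "degree (0 :: 'a poly) < 1 * degree D" by auto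
qed (use assms(2) in auto)

lemma digit_smult:
  assumes D: "irreducible D"
  shows "digit D (to_fract [:c:] * z) = smult c (digit D z)"
proof -
  from is_digit_digit[OF D, of z] obtain n E N B where *: "degree (digit D z) < degree D"
    "degree E < n * degree D" "\<not> D dvd B"
    "z = to_fract (digit D z) + to_fract E / to_fract (D ^ n) + to_fract (D * N) / to_fract B"
    unfolding is_digit_def by blast
  have sm: "to_fract (smult c p) = to_fract [:c:] * to_fract p" for p
    by (simp flip: to_fract_mult)
  have "D \<noteq> 0" "B \<noteq> 0" using D * by auto
  then have "to_fract [:c:] * z = to_fract (smult c (digit D z)) + to_fract (smult c E) / to_fract (D ^ n)
    + to_fract (D * smult c N) / to_fract B"
    by (subst *(4)) (simp add: sm field_simps del: mult_smult_right)
  moreover have "0 < n"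
    using *(2) by (cases n) auto
  ultimately show ?thesis
    using * by (intro digit_eq[OF D] is_digitI) (auto intro: le_less_trans[OF degree_smult_le] simp del: mult_smult_right to_fract_mult)
qed

section \<open>Gauss's lemma\<close>

text \<open>
  The library versions need gcd structure on the coefficients, which \<^typ>\<open>'a poly\<close> lacks when
  \<open>'a\<close> is merely a field.
\<close>

lemma field_poly_prime_divisor_exists:
  fixes r :: "'a::field poly"
  assumes "r \<noteq> 0" "\<not> is_unit r"
  shows "\<exists>p. prime_elem p \<and> p dvd r"
  using assms
proof (induction "degree r" arbitrary: r rule: less_induct)
  case less
  show ?case
  proof (cases "irreducible r")
    case True
    then show ?thesis
      by (intro exI[of _ r] conjI field_poly_irreducible_imp_prime dvd_refl)
  next
    case False
    then have "\<exists>a b. r = a * b \<and> \<not> is_unit a \<and> \<not> is_unit b"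
      using less.prems by (auto simp: irreducible_def)
    then obtain a b where ab: "r = a * b" "\<not> is_unit a" "\<not> is_unit b"
      by blast
    from less.prems(1) have nz: "a \<noteq> 0" "b \<noteq> 0"
      by (simp_all add: ab(1))
    from nz(2) ab(3) have "degree b \<noteq> 0"
      using is_unit_iff_degree by blast
    with nz have "degree a < degree r"
      by (simp add: ab(1) degree_mult_eq)
    from less.hyps[OF this nz(1) ab(2)] obtain p where "prime_elem p" "p dvd a"
      by blast
    then show ?thesis
      unfolding ab(1) by (intro exI[of _ p] conjI dvd_mult2)
  qed
qed

text \<open>A prime factor of the scalar \<open>r\<close> stays prime as a constant polynomial, so
  it divides \<open>g\<close> or \<open>h\<close> and can be cancelled there. Induction on
  \<open>degree r\<close> distributes all of \<open>r\<close> over the two factors.\<close>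

lemma smult_eq_mult_factors:
  fixes f g h :: "'a::field poly poly"
  assumes "r \<noteq> 0" "smult r f = g * h"
  shows "\<exists>s s' g' h'. s * s' = r \<and> g = smult s g' \<and> h = smult s' h' \<and> f = g' * h'"
  using assms
proof (induction "degree r" arbitrary: r g h rule: less_induct)
  case less
  show ?case
  proof (cases "is_unit r")
    case True
    then obtain r' where r': "1 = r * r'" by (rule dvdE)
    have "f = smult r' (smult r f)"
      using r' by (simp add: mult.commute)
    also have "\<dots> = smult r' g * h"
      by (simp add: less.prems(2))
    finally show ?thesis
      using r' by (intro exI[of _ r] exI[of _ 1] exI[of _ "smult r' g"] exI[of _ h]) simp
  next
    case False
    from field_poly_prime_divisor_exists[OF less.prems(1) this]
    obtain p where p: "prime_elem p" and "p dvd r" by (elim exE conjE)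
    from \<open>p dvd r\<close> obtain r1 where r1: "r = p * r1" by (rule dvdE)
    have p0: "p \<noteq> 0" "r1 \<noteq> 0" using less.prems(1) by (auto simp: r1)
    have "degree p \<noteq> 0"
      using p0 is_unit_iff_degree[of p] prime_elem_not_unit[OF p] by simp
    then have "degree r1 < degree r"
      using p0 by (simp add: r1 degree_mult_eq)
    note IH = less.hyps[OF this p0(2)]
    have "[:p:] dvd g * h"
      unfolding less.prems(2)[symmetric] r1 by (simp add: const_poly_dvd_iff)
    then have "[:p:] dvd g \<or> [:p:] dvd h"
      using lift_prime_elem_poly[OF p] by (simp add: prime_elem_dvd_mult_iff)
    then show ?thesis
    proof
      assume "[:p:] dvd g"
      then obtain g1 where "g = [:p:] * g1" by (rule dvdE)
      then have g1: "g = smult p g1" by simp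
      have "smult p (smult r1 f) = smult p (g1 * h)"
        using less.prems(2) by (simp add: r1 g1)
      then have "smult r1 f = g1 * h"
        by (rule smult_cancel[OF p0(1)])
      from IH[OF this] obtain s s' g' h' where
        "s * s' = r1" "g1 = smult s g'" "h = smult s' h'" "f = g' * h'" by (elim exE conjE)
      then show ?thesis
        by (intro exI[of _ "p * s"] exI[of _ s'] exI[of _ g'] exI[of _ h']) (simp add: r1 g1)
    next
      assume "[:p:] dvd h"
      then obtain h1 where "h = [:p:] * h1" by (rule dvdE)
      then have h1: "h = smult p h1" by simp
      have "smult p (smult r1 f) = smult p (g * h1)"
        using less.prems(2) by (simp add: r1 h1)
      then have "smult r1 f = g * h1"
        by (rule smult_cancel[OF p0(1)])
      from IH[OF this] obtain s s' g' h' where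
        "s * s' = r1" "g = smult s g'" "h1 = smult s' h'" "f = g' * h'" by (elim exE conjE)
      then show ?thesis
        by (intro exI[of _ s] exI[of _ "p * s'"] exI[of _ g'] exI[of _ h']) (simp add: r1 h1 mult_ac)
    qed
  qed
qed

lemma clear_denominators:
  fixes G :: "'b::idom fract poly"
  obtains r g where "r \<noteq> 0" "smult (to_fract r) G = fract_poly g"
proof -
  have "\<exists>r g. r \<noteq> 0 \<and> smult (to_fract r) G = fract_poly g"
  proof (induction G)
    case 0
    show ?case by (intro exI[of _ 1] exI[of _ 0]) simp
  next
    case (pCons c G)
    then obtain r g where rg: "r \<noteq> 0" "smult (to_fract r) G = fract_poly g" by blast
    obtain a b where c: "c = Fract a b" "b \<noteq> 0" by (cases c)
    have "smult (to_fract (b * r)) (pCons c G) = fract_poly (pCons (r * a) (smult b g))"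
      using c by (simp add: map_poly_pCons Fract_conv_to_fract field_simps flip: rg(2))
    then show ?case
      using rg(1) c(2) by (intro exI[of _ "b * r"] exI[of _ "pCons (r * a) (smult b g)"]) simp
  qed
  then show thesis using that by blast
qed

lemma degree_fract_poly [simp]: "degree (fract_poly p) = degree p"
  by (rule degree_map_poly) simp

lemma is_unit_poly_degree: "is_unit p \<Longrightarrow> degree p = 0" for p :: "'b::idom_divide poly"
  by (auto simp: is_unit_poly_iff)

text \<open>Clearing denominators turns a factorization over K(x) into one over K[x] with the same
  degrees in y. One of the new factors is a unit, so one of the original factors has degree
  0.\<close>

lemma irreducible_fract_poly:
  fixes d :: "'a::field poly poly"
  assumes d: "irreducible d" "degree d > 0"
  shows "irreducible (fract_poly d)"
proof (rule irreducibleI)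
  show "fract_poly d \<noteq> 0"
    using d(2) by auto
  show "\<not> is_unit (fract_poly d)"
    using d(2) is_unit_poly_degree[of "fract_poly d"] by auto
  fix G H assume GH: "fract_poly d = G * H"
  obtain r g where g: "r \<noteq> 0" "smult (to_fract r) G = fract_poly g" by (rule clear_denominators)
  obtain r' h where h: "r' \<noteq> 0" "smult (to_fract r') H = fract_poly h" by (rule clear_denominators)
  have "fract_poly (smult (r * r') d) = fract_poly (g * h)"
    by (simp add: GH mult_ac flip: g(2) h(2))
  then have rd: "smult (r * r') d = g * h"
    by (simp only: fract_poly_eq_iff)
  have nz: "r * r' \<noteq> 0" using g(1) h(1) by simp
  obtain s s' g' h' where *: "s * s' = r * r'" "g = smult s g'" "h = smult s' h'" "d = g' * h'"
    using smult_eq_mult_factors[OF nz rd] by (elim exE conjE)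
  have s: "s \<noteq> 0" "s' \<noteq> 0" using nz *(1) by auto
  have "degree G = degree g" "degree H = degree h"
    using g(1) h(1) arg_cong[OF g(2), of degree] arg_cong[OF h(2), of degree] by simp_all
  then have deg: "degree G = degree g'" "degree H = degree h'"
    using s by (simp_all add: *(2,3))
  have "is_unit g' \<or> is_unit h'"
    using irreducibleD[OF d(1) *(4)] .
  then have "degree G = 0 \<or> degree H = 0"
    unfolding deg by (elim disjE) (simp_all add: is_unit_poly_degree)
  moreover have "G \<noteq> 0" "H \<noteq> 0"
    using \<open>fract_poly d \<noteq> 0\<close> GH by auto
  ultimately show "is_unit G \<or> is_unit H"
    by (simp add: is_unit_iff_degree)
qed

text \<open>The quotient is a priori an element of K(x). It lies in K because an irreducible
  polynomial of positive degree in y has no nonconstant factor in K[x].\<close>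

lemma fract_poly_dvd_imp_smult:
  fixes d1 d2 :: "'a::field poly poly"
  assumes d1: "irreducible d1" "degree d1 > 0" and d2: "irreducible d2" "degree d2 > 0"
    and dvd: "fract_poly d1 dvd fract_poly d2"
  obtains c where "d2 = smult [:c:] d1"
proof -
  obtain W where W: "fract_poly d2 = fract_poly d1 * W" using dvd by (rule dvdE)
  have "is_unit W"
    using irreducibleD[OF irreducible_fract_poly[OF d2] W]
      irreducible_not_unit[OF irreducible_fract_poly[OF d1]] by blast
  then obtain w where w: "W = [:w:]" by (auto simp: is_unit_poly_iff)
  obtain a b where ab: "w = Fract a b" "b \<noteq> 0" by (cases w)
  have "fract_poly (smult b d2) = fract_poly ([:a:] * d1)"
    using W ab(2) by (simp add: w ab(1) Fract_conv_to_fract)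
  then have "smult b d2 = [:a:] * d1"
    by (simp only: fract_poly_eq_iff)
  from smult_eq_mult_factors[OF ab(2) this] obtain s s' g' h'
    where *: "s * s' = b" "[:a:] = smult s g'" "d1 = smult s' h'" "d2 = g' * h'"
    by (elim exE conjE)
  have s: "s \<noteq> 0" "s' \<noteq> 0" using ab(2) *(1) by auto
  have "degree h' > 0"
    using d1(2) s(2) by (simp add: *(3))
  then have nu: "\<not> is_unit h'" using is_unit_poly_degree[of h'] by auto
  have "d1 = [:s':] * h'" using *(3) by simp
  then have "is_unit [:s':]" using irreducibleD[OF d1(1)] nu by blast
  then have "is_unit s'" by (simp add: is_unit_const_poly_iff)
  then obtain c1 where c1: "s' = [:c1:]" by (auto simp: is_unit_poly_iff)
  with s(2) have "c1 \<noteq> 0" by auto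
  have "is_unit g'" using irreducibleD[OF d2(1) *(4)] nu by blast
  then obtain c2 where c2: "g' = [:[:c2:]:]" by (auto simp: is_unit_poly_iff)
  have "d2 = smult [:c2 / c1:] d1"
    using \<open>c1 \<noteq> 0\<close> by (simp add: *(3,4) c1 c2)
  then show thesis by (rule that)
qed

lemma irreducible_automorphism:
  fixes \<phi> \<psi> :: "'b::algebraic_semidom \<Rightarrow> 'b"
  assumes "\<And>a b. \<psi> (a * b) = \<psi> a * \<psi> b" "\<And>a b. \<phi> (a * b) = \<phi> a * \<phi> b" "\<phi> 1 = 1" "\<psi> 1 = 1" "\<psi> 0 = 0"
    and inv: "\<And>a. \<phi> (\<psi> a) = a" "\<And>a. \<psi> (\<phi> a) = a" and p: "irreducible p"
  shows "irreducible (\<phi> p)"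
proof -
  have unit: "is_unit (\<psi> a) \<longleftrightarrow> is_unit a" for a
  proof
    assume "is_unit a"
    then obtain b where "1 = a * b" by (rule dvdE)
    then have "1 = \<psi> a * \<psi> b"
      using assms(1)[of a b] \<open>\<psi> 1 = 1\<close> by simp
    then show "is_unit (\<psi> a)" by (rule dvdI)
  next
    assume "is_unit (\<psi> a)"
    then obtain b where "1 = \<psi> a * b" by (rule dvdE)
    then have "1 = a * \<phi> b"
      using assms(2)[of "\<psi> a" b] \<open>\<phi> 1 = 1\<close> inv(1) by simp
    then show "is_unit a" by (rule dvdI)
  qed
  show ?thesis
  proof (rule irreducibleI)
    show "\<phi> p \<noteq> 0"
      using p inv(2)[of p] \<open>\<psi> 0 = 0\<close> by (auto simp: irreducible_def)
    show "\<not> is_unit (\<phi> p)"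
      using p unit[of "\<phi> p"] irreducible_not_unit[OF p] by (simp add: inv(2))
    fix a b assume "\<phi> p = a * b"
    then have "p = \<psi> a * \<psi> b"
      using inv(2)[of p] assms(1)[of a b] by simp
    then show "is_unit a \<or> is_unit b"
      using irreducibleD[OF p, of "\<psi> a" "\<psi> b"] unit[of a] unit[of b] by simp
  qed
qed

section \<open>Scaling the variables\<close>

definition scale_ratfun1 :: "'a::field \<Rightarrow> 'a poly fract \<Rightarrow> 'a poly fract" where
  "scale_ratfun1 c = map_fract (\<lambda>u. u \<circ>\<^sub>p [:0, c:])"

definition scale_xy :: "'a::field \<Rightarrow> 'a \<Rightarrow> 'a poly fract poly \<Rightarrow> 'a poly fract poly" where
  "scale_xy c e u = map_poly (scale_ratfun1 c) (u \<circ>\<^sub>p [:0, to_fract [:e:]:])"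

text \<open>Both shifts belong to one two-parameter family, in which composition multiplies the
  parameters.\<close>

definition tau :: "'a::field \<Rightarrow> 'a \<Rightarrow> 'a ratfun \<Rightarrow> 'a ratfun" where
  "tau c e r = tau_x c (tau_y e r)"

definition scale_poly :: "'a::field \<Rightarrow> 'a \<Rightarrow> 'a poly poly \<Rightarrow> 'a poly poly" where
  "scale_poly c e d = map_poly (\<lambda>u. u \<circ>\<^sub>p [:0, c:]) (d \<circ>\<^sub>p [:0, [:e:]:])"

context
  fixes c :: "'a::field"
  assumes c: "c \<noteq> 0"
begin

lemma scale_ratfun1_Fract:
  "b \<noteq> 0 \<Longrightarrow> scale_ratfun1 c (Fract a b) = Fract (a \<circ>\<^sub>p [:0, c:]) (b \<circ>\<^sub>p [:0, c:])"
  unfolding scale_ratfun1_def by (rule map_fract_scale) (use c in simp_all)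

lemma scale_ratfun1_mult: "scale_ratfun1 c (r * s) = scale_ratfun1 c r * scale_ratfun1 c s"
  unfolding scale_ratfun1_def
  by (rule map_fract_mult) (use c in \<open>simp_all add: pcompose_mult pcompose_scale_zero_iff\<close>)

lemma scale_ratfun1_add: "scale_ratfun1 c (r + s) = scale_ratfun1 c r + scale_ratfun1 c s"
  unfolding scale_ratfun1_def
  by (rule map_fract_add)
    (use c in \<open>simp_all add: pcompose_mult pcompose_add pcompose_scale_zero_iff\<close>)

lemma scale_ratfun1_eq_0_iff: "scale_ratfun1 c r = 0 \<longleftrightarrow> r = 0"
  unfolding scale_ratfun1_def
  by (rule map_fract_zero_iff) (use c in \<open>simp_all add: pcompose_mult pcompose_scale_zero_iff\<close>)

lemma scale_ratfun1_to_fract: "scale_ratfun1 c (to_fract u) = to_fract (u \<circ>\<^sub>p [:0, c:])"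
  by (simp add: to_fract_def scale_ratfun1_Fract pcompose_1)

lemma scale_ratfun1_scale:
  assumes "c' \<noteq> 0"
  shows "scale_ratfun1 c' (scale_ratfun1 c r) = scale_ratfun1 (c' * c) r"
proof (cases r)
  case (Fract a b)
  have "scale_ratfun1 (c' * c) (Fract a b) = Fract (a \<circ>\<^sub>p [:0, c' * c:]) (b \<circ>\<^sub>p [:0, c' * c:])"
    unfolding scale_ratfun1_def by (rule map_fract_scale) (use c assms Fract in simp_all)
  moreover have "scale_ratfun1 c' (Fract (a \<circ>\<^sub>p [:0, c:]) (b \<circ>\<^sub>p [:0, c:]))
      = Fract (a \<circ>\<^sub>p [:0, c:] \<circ>\<^sub>p [:0, c':]) (b \<circ>\<^sub>p [:0, c:] \<circ>\<^sub>p [:0, c':])"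
    unfolding scale_ratfun1_def
    by (rule map_fract_scale) (use c assms Fract in \<open>simp_all add: pcompose_scale_zero_iff\<close>)
  ultimately show ?thesis
    using Fract(2) by (simp add: Fract(1) scale_ratfun1_Fract pcompose_pCons mult.commute flip: pcompose_assoc)
qed

end

lemma scale_ratfun1_1: "scale_ratfun1 1 r = r"
proof (cases r)
  case (Fract a b)
  have "u \<circ>\<^sub>p [:0, 1:] = u" for u :: "'a poly"
    by (intro poly_eqI) (simp add: coeff_pcompose_linear)
  with Fract show ?thesis by (simp add: scale_ratfun1_Fract)
qed

lemma coeff_scale_xy:
  assumes "c \<noteq> 0"
  shows "coeff (scale_xy c e u) n = to_fract [:e ^ n:] * scale_ratfun1 c (coeff u n)"
proof -
  have *: "[:e:] ^ n = [:e ^ n:]" by (induction n) (simp_all add: one_pCons)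
  then show ?thesis
    using assms
    by (simp add: scale_xy_def coeff_map_poly scale_ratfun1_eq_0_iff coeff_pcompose_linear
        scale_ratfun1_mult scale_ratfun1_to_fract flip: to_fract_power)
qed

lemma scale_xy_scale_xy:
  assumes "c \<noteq> 0" "c' \<noteq> 0"
  shows "scale_xy c e (scale_xy c' e' u) = scale_xy (c * c') (e * e') u"
  using assms
  by (intro poly_eqI) (simp add: coeff_scale_xy scale_ratfun1_mult scale_ratfun1_to_fract
      scale_ratfun1_scale power_mult_distrib flip: to_fract_mult mult.assoc)

lemma scale_xy_0 [simp]: "scale_xy c e 0 = 0"
  by (simp add: scale_xy_def)

lemma scale_xy_1_1: "scale_xy 1 1 u = u"
  by (intro poly_eqI) (simp add: coeff_scale_xy scale_ratfun1_1 flip: one_pCons)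

context
  fixes c e :: "'a::field"
  assumes c: "c \<noteq> 0" and e: "e \<noteq> 0"
begin

lemma scale_xy_mult: "scale_xy c e (u * w) = scale_xy c e u * scale_xy c e w"
  using map_poly_map_fract_scale(1)[OF c]
  by (simp add: scale_xy_def scale_ratfun1_def pcompose_mult)

lemma scale_xy_add: "scale_xy c e (u + w) = scale_xy c e u + scale_xy c e w"
  using c by (intro poly_eqI) (simp add: coeff_scale_xy scale_ratfun1_add algebra_simps)

lemma scale_xy_inverse: "scale_xy (inverse c) (inverse e) (scale_xy c e u) = u"
  "scale_xy c e (scale_xy (inverse c) (inverse e) u) = u"
  using c e by (simp_all add: scale_xy_scale_xy scale_xy_1_1)

lemma scale_xy_eq_0_iff: "scale_xy c e u = 0 \<longleftrightarrow> u = 0"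
  by (metis scale_xy_0 scale_xy_inverse(1))

lemma scale_xy_const: "scale_xy c e [:to_fract [:k:]:] = [:to_fract [:k:]:]"
  using c e by (intro poly_eqI)
    (simp add: coeff_scale_xy coeff_pCons scale_ratfun1_to_fract pcompose_pCons scale_ratfun1_eq_0_iff
      flip: one_pCons split: nat.splits)

lemma scale_xy_1 [simp]: "scale_xy c e 1 = 1"
  using scale_xy_const[of 1] by (simp flip: one_pCons)

lemma degree_scale_xy: "degree (scale_xy c e u) = degree u"
proof -
  have "coeff (scale_xy c e u) n = 0 \<longleftrightarrow> coeff u n = 0" for n
    using c e by (simp add: coeff_scale_xy scale_ratfun1_eq_0_iff)
  then show ?thesis by (simp add: degree_def)
qed

lemma scale_xy_power: "scale_xy c e (u ^ n) = scale_xy c e u ^ n"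
  by (induction n) (simp_all add: scale_xy_mult)

lemma scale_xy_dvd_iff: "scale_xy c e u dvd scale_xy c e w \<longleftrightarrow> u dvd w"
proof
  assume "scale_xy c e u dvd scale_xy c e w"
  then obtain v where "scale_xy c e w = scale_xy c e (u * scale_xy (inverse c) (inverse e) v)"
    by (auto simp: scale_xy_mult scale_xy_inverse elim!: dvdE)
  then have "w = u * scale_xy (inverse c) (inverse e) v"
    by (metis scale_xy_inverse(1))
  then show "u dvd w" by simp
qed (auto simp: scale_xy_mult)

lemma tau_Fract: "w \<noteq> 0 \<Longrightarrow> tau c e (Fract u w) = Fract (scale_xy c e u) (scale_xy c e w)"
  using c e unfolding tau_def
  by (simp add: tau_y_Fract tau_x_Fract pcompose_scale_zero_iff scale_xy_def scale_ratfun1_def)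

lemma tau_to_fract: "tau c e (to_fract u) = to_fract (scale_xy c e u)"
  by (simp add: to_fract_def tau_Fract)

lemma tau_add: "tau c e (r + s) = tau c e r + tau c e s"
proof (cases r; cases s)
  fix a b a' b' assume "r = Fract a b" "b \<noteq> 0" "s = Fract a' b'" "b' \<noteq> 0"
  then show ?thesis by (simp add: tau_Fract scale_xy_add scale_xy_mult scale_xy_eq_0_iff)
qed

lemma tau_mult: "tau c e (r * s) = tau c e r * tau c e s"
proof (cases r; cases s)
  fix a b a' b' assume "r = Fract a b" "b \<noteq> 0" "s = Fract a' b'" "b' \<noteq> 0"
  then show ?thesis by (simp add: tau_Fract scale_xy_mult)
qed

lemma tau_0 [simp]: "tau c e 0 = 0"
  using tau_to_fract[of 0] by simp

lemma tau_1 [simp]: "tau c e 1 = 1"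
  using tau_to_fract[of 1] by simp

lemma tau_diff: "tau c e (r - s) = tau c e r - tau c e s"
  using tau_add[of "r - s" s] by simp

lemma tau_power: "tau c e (r ^ n) = tau c e r ^ n"
  by (induction n) (simp_all add: tau_mult)

lemma tau_divide: "tau c e (r / s) = tau c e r / tau c e s"
proof (cases "s = 0")
  case False
  then have "tau c e (r / s) * tau c e s = tau c e r" "tau c e (inverse s) * tau c e s = 1"
    by (simp_all flip: tau_mult)
  then show ?thesis by (metis mult_zero_right nonzero_eq_divide_eq zero_neq_one)
qed simp

end

lemma irreducible_scale_xy:
  assumes "c \<noteq> 0" "e \<noteq> 0" "irreducible u"
  shows "irreducible (scale_xy c e u)"
  by (rule irreducible_automorphism[where \<psi> = "scale_xy (inverse c) (inverse e)"])
    (use assms in \<open>simp_all add: scale_xy_inverse scale_xy_mult\<close>)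

lemma tau_tau:
  assumes "c \<noteq> 0" "e \<noteq> 0" "c' \<noteq> 0" "e' \<noteq> 0"
  shows "tau c e (tau c' e' r) = tau (c * c') (e * e') r"
proof (cases r)
  case (Fract a b)
  then show ?thesis
    using assms by (simp add: tau_Fract scale_xy_scale_xy scale_xy_eq_0_iff)
qed

lemma tau_1_1 [simp]: "tau 1 1 r = r"
  by (cases r) (simp add: tau_Fract scale_xy_1_1)

lemma tau_y_eq: "e \<noteq> 0 \<Longrightarrow> tau_y e = tau 1 e"
proof
  fix r :: "'a ratfun" assume "e \<noteq> 0"
  have "map_poly (map_fract (\<lambda>u. u \<circ>\<^sub>p [:0, 1:])) u = u" for u :: "'a poly fract poly"
    unfolding scale_ratfun1_def[symmetric] by (simp add: scale_ratfun1_1 map_poly_idI)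
  then have "tau_x 1 s = s" for s :: "'a ratfun"
    by (cases s) (simp only: tau_x_Fract[OF one_neq_zero] not_False_eq_True)
  then show "tau_y e r = tau 1 e r" by (simp add: tau_def)
qed

lemma tau_x_eq: "c \<noteq> 0 \<Longrightarrow> tau_x c = tau c 1"
proof
  fix r :: "'a ratfun" assume "c \<noteq> 0"
  have "tau_y 1 r = r"
    using tau_y_eq[of "1 :: 'a"] by simp
  then show "tau_x c r = tau c 1 r" by (simp add: tau_def)
qed

text \<open>Inverting the operator inverts both parameters, so negative exponents follow the same
  rule as positive ones.\<close>

lemma funpow_int_tau:
  assumes "c \<noteq> 0" "e \<noteq> 0"
  shows "funpow_int (tau c e) k = tau (c powi k) (e powi k)"
proof -
  have pow: "tau c e ^^ n = tau (c ^ n) (e ^ n)" if "c \<noteq> 0" "e \<noteq> 0" for c e :: 'a and n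
    using that by (induction n) (auto simp: fun_eq_iff tau_tau)
  have "inv (tau c e) = tau (inverse c) (inverse e)"
    using assms by (intro inv_unique_comp) (auto simp: fun_eq_iff tau_tau)
  then show ?thesis
    using assms by (auto simp: funpow_int_def pow power_int_def)
qed

lemma poly_ratfun_eq_iff [simp]: "poly_ratfun p = poly_ratfun p' \<longleftrightarrow> p = p'"
  by (simp add: poly_ratfun_def)

context
  fixes c e :: "'a::field"
  assumes c: "c \<noteq> 0" and e: "e \<noteq> 0"
begin

lemma coeff_scale_poly: "coeff (coeff (scale_poly c e d) n) i = e ^ n * c ^ i * coeff (coeff d n) i"
proof -
  have "[:e:] ^ n = [:e ^ n:]" by (induction n) (simp_all add: one_pCons)
  then show ?thesis
    by (simp add: scale_poly_def coeff_map_poly coeff_pcompose_linear)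
qed

lemma scale_xy_fract_poly: "scale_xy c e (fract_poly d) = fract_poly (scale_poly c e d)"
proof (intro poly_eqI)
  fix n
  have "[:e ^ n:] * (coeff d n \<circ>\<^sub>p [:0, c:]) = coeff (scale_poly c e d) n"
    by (intro poly_eqI) (simp add: coeff_scale_poly coeff_pcompose_linear)
  then show "coeff (scale_xy c e (fract_poly d)) n = coeff (fract_poly (scale_poly c e d)) n"
    using c e by (simp add: coeff_scale_xy coeff_map_poly scale_ratfun1_to_fract flip: to_fract_mult)
qed

lemma scale_poly_mult: "scale_poly c e (d * d') = scale_poly c e d * scale_poly c e d'"
proof -
  have "fract_poly (scale_poly c e (d * d')) = fract_poly (scale_poly c e d * scale_poly c e d')"
    using c e by (simp add: scale_xy_mult del: fract_poly_eq_iff flip: scale_xy_fract_poly)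
  then show ?thesis by (simp only: fract_poly_eq_iff)
qed

lemma scale_poly_1: "scale_poly c e 1 = 1"
  using scale_xy_fract_poly[of 1] c e by (metis fract_poly_1 fract_poly_eq_iff scale_xy_1)

lemma degree_scale_poly: "degree (scale_poly c e d) = degree d"
  using c e degree_scale_xy[of c e "fract_poly d"] by (simp add: scale_xy_fract_poly)

end

lemma scale_poly_inverse:
  assumes "c \<noteq> 0" "e \<noteq> 0"
  shows "scale_poly (inverse c) (inverse e) (scale_poly c e d) = d"
    "scale_poly c e (scale_poly (inverse c) (inverse e) d) = d"
  using assms by (intro poly_eqI; simp add: coeff_scale_poly field_simps)+

lemma irreducible_scale_poly:
  assumes "c \<noteq> 0" "e \<noteq> 0" "irreducible d"
  shows "irreducible (scale_poly c e d)"
proof (rule irreducible_automorphism[where \<phi> = "scale_poly c e" and \<psi> = "scale_poly (inverse c) (inverse e)"])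
  show "scale_poly (inverse c) (inverse e) 0 = 0"
    by (simp add: scale_poly_def)
qed (use assms in \<open>simp_all add: scale_poly_inverse scale_poly_mult scale_poly_1\<close>)

lemma poly_ratfun_smult: "poly_ratfun (smult [:k:] p) = const_ratfun k * poly_ratfun p"
  by (simp add: poly_ratfun_def const_ratfun_def flip: to_fract_mult)

lemma tau_poly_ratfun:
  "c \<noteq> 0 \<Longrightarrow> e \<noteq> 0 \<Longrightarrow> tau c e (poly_ratfun d) = poly_ratfun (scale_poly c e d)"
  by (simp add: poly_ratfun_def tau_to_fract scale_xy_fract_poly)

lemma power_int_inject_non_root_of_unity:
  fixes q :: "'a::field"
  assumes "q \<noteq> 0" "\<forall>n::nat. n > 0 \<longrightarrow> q ^ n \<noteq> 1" "q powi a = q powi b"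
  shows "a = b"
proof -
  have *: "a \<le> b" if "q powi a = q powi b" for a b
  proof (rule ccontr)
    assume "\<not> a \<le> b"
    then have "nat (a - b) > 0" "q ^ nat (a - b) = q powi (a - b)"
      by (simp_all add: power_int_def)
    moreover have "q powi (a - b) = 1"
      using assms(1) that by (simp add: power_int_diff)
    ultimately show False
      using assms(2) by metis
  qed
  show ?thesis using *[OF assms(3)] *[OF assms(3)[symmetric]] by simp
qed

section \<open>Shift relations\<close>

text \<open>Scalings act diagonally on monomials. As \<open>q\<close> is not a root of unity,
  comparing coefficients amounts to comparing exponents of \<open>q\<close>: the support of
  \<open>d\<close> lies on a line.\<close>

lemma shift_related_iff_support:
  fixes q :: "'a::field"
  assumes q: "q \<noteq> 0" "\<forall>n::nat. n > 0 \<longrightarrow> q ^ n \<noteq> 1"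
  shows "shift_related q d t l v \<longleftrightarrow>
    (\<forall>n i. coeff (coeff d n) i \<noteq> 0 \<longrightarrow> t * int i = v + l * int n)"
proof -
  have pow: "(q powi k) ^ n = q powi (k * int n)" for k n
    by (simp add: power_int_mult)
  have "shift_related q d t l v \<longleftrightarrow>
      scale_poly (q powi t) 1 d = smult [:q powi v:] (scale_poly 1 (q powi l) d)"
    using q(1) by (simp add: shift_related_def tau_x_eq tau_y_eq funpow_int_tau tau_poly_ratfun
        flip: poly_ratfun_smult)
  also have "\<dots> \<longleftrightarrow> (\<forall>n i. q powi (t * int i) * coeff (coeff d n) i
      = q powi (v + l * int n) * coeff (coeff d n) i)"
    using q(1) by (simp add: poly_eq_iff coeff_scale_poly pow power_int_add mult.assoc)
  also have "\<dots> \<longleftrightarrow> (\<forall>n i. coeff (coeff d n) i \<noteq> 0 \<longrightarrow> t * int i = v + l * int n)"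
    unfolding mult_cancel_right using power_int_inject_non_root_of_unity[OF q] by metis
  finally show ?thesis .
qed

text \<open>Gauss's lemma turns divisibility into equality up to a constant \<open>c\<close> of K.
  Comparing coefficients at a single monomial of \<open>d\<close> exhibits \<open>c\<close> as a
  power of \<open>q\<close>.\<close>

lemma shift_relatedI_dvd:
  fixes q :: "'a::field"
  assumes q: "q \<noteq> 0" "\<forall>n::nat. n > 0 \<longrightarrow> q ^ n \<noteq> 1"
    and d: "irreducible d" "degree d > 0"
    and dvd: "fract_poly d dvd scale_xy (q powi i) (q powi k) (fract_poly d)"
  shows "\<exists>v. shift_related q d i (- k) v"
proof -
  have nz: "q powi i \<noteq> 0" "q powi k \<noteq> 0" using q(1) by simp_all
  obtain c where c: "scale_poly (q powi i) (q powi k) d = smult [:c:] d"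
    using dvd fract_poly_dvd_imp_smult[OF d irreducible_scale_poly[OF nz d(1)]] d(2)
    by (auto simp: scale_xy_fract_poly[OF nz] degree_scale_poly[OF nz])
  have pow: "(q powi k) ^ n = q powi (k * int n)" for k n
    by (simp add: power_int_mult)
  have supp: "q powi (k * int n + i * int m) = c" if "coeff (coeff d n) m \<noteq> 0" for n m
  proof -
    have "coeff (coeff (scale_poly (q powi i) (q powi k) d) n) m = c * coeff (coeff d n) m"
      by (simp add: c)
    then show ?thesis
      using that q(1) by (simp add: coeff_scale_poly[OF nz] pow power_int_add)
  qed
  \<comment> \<open>Any monomial in the support of \<open>d\<close> would serve; this is a leading
    one.\<close>
  define n0 where "n0 = degree d"
  define m0 where "m0 = degree (coeff d n0)"
  have "coeff (coeff d n0) m0 \<noteq> 0"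
    using d(2) by (auto simp: n0_def m0_def)
  note s0 = supp[OF this]
  have "k * int n + i * int m = k * int n0 + i * int m0" if "coeff (coeff d n) m \<noteq> 0" for n m
    using power_int_inject_non_root_of_unity[OF q] s0 supp[OF that] by metis
  then have "shift_related q d i (- k) (k * int n0 + i * int m0)"
    unfolding shift_related_iff_support[OF q] by (simp add: algebra_simps)
  then show ?thesis ..
qed

text \<open>If \<open>l\<close> were nonzero, all monomials of \<open>d\<close> would have the same
  degree in y. Irreducibility would then leave only the constant multiples of y, which
  \<open>\<tau>\<^sub>y\<close> indeed multiplies by \<open>q\<close>.\<close>

lemma shift_related_0_imp:
  fixes q :: "'a::field"
  assumes q: "q \<noteq> 0" "\<forall>n::nat. n > 0 \<longrightarrow> q ^ n \<noteq> 1"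
    and d: "irreducible d" "degree d > 0" "\<forall>c. d \<noteq> smult [:c:] [:0, 1:]"
    and rel: "shift_related q d 0 l v"
  shows "l = 0"
proof (rule ccontr)
  assume l: "l \<noteq> 0"
  from rel have supp: "v + l * int n = 0" if "coeff (coeff d n) i \<noteq> 0" for n i
    using that unfolding shift_related_iff_support[OF q] by force
  have coeff0: "coeff d n = 0" if n: "n \<noteq> degree d" for n
  proof (rule ccontr)
    assume "coeff d n \<noteq> 0"
    then have "v + l * int n = 0"
      by (intro supp[of n "degree (coeff d n)"]) simp
    moreover have "v + l * int (degree d) = 0"
      using d(2) by (intro supp[of _ "degree (lead_coeff d)"]) auto
    ultimately have "l * int n = l * int (degree d)" by linarith
    with l n show False by simp
  qed
  \<comment> \<open>This is the cofactor of y in \<open>d\<close>.\<close>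
  define e where "e = monom (lead_coeff d) (degree d - 1)"
  have "d = monom (lead_coeff d) (Suc (degree d - 1))"
    using coeff0 d(2) by (intro poly_eqI) auto
  then have de: "d = [:0, 1:] * e"
    by (simp add: e_def monom_Suc)
  have "\<not> is_unit ([:0, 1:] :: 'a poly poly)"
    using is_unit_poly_degree[of "[:0, 1:] :: 'a poly poly"] by auto
  then have "is_unit e"
    using irreducibleD[OF d(1) de] by blast
  then obtain c where "e = [:[:c:]:]"
    by (auto simp: is_unit_poly_iff)
  with de d(3) show False by simp
qed

section \<open>Digits under scaling of the variables\<close>

lemma is_digit_tau:
  assumes c: "c \<noteq> 0" "e \<noteq> 0" and "is_digit D z u"
  shows "is_digit (scale_xy c e D) (tau c e z) (scale_xy c e u)"
proof -
  from assms(3) obtain n E N B where *: "degree u < degree D"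
    "degree E < n * degree D" "\<not> D dvd B"
    "z = to_fract u + to_fract E / to_fract (D ^ n) + to_fract (D * N) / to_fract B"
    unfolding is_digit_def by blast
  show ?thesis
    by (rule is_digitI[where n = n and E = "scale_xy c e E" and B = "scale_xy c e B"
          and N = "scale_xy c e N"])
      (use c * in \<open>simp_all add: degree_scale_xy scale_xy_dvd_iff tau_add tau_divide tau_to_fract
          scale_xy_power scale_xy_mult del: to_fract_mult\<close>)
qed

text \<open>In general a scaling also moves \<open>D\<close>; here it preserves \<open>D\<close> up
  to a constant, so both digits refer to the same polynomial.\<close>

lemma digit_tau:
  assumes c: "c \<noteq> 0" "e \<noteq> 0" and D: "irreducible D" "scale_xy c e D = smult k D"
  shows "digit D (tau c e z) = scale_xy c e (digit D z)"
proof (rule digit_eq[OF D(1)])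
  have "D \<noteq> 0" using D(1) by auto
  then have "k \<noteq> 0"
    using D(2) scale_xy_eq_0_iff[OF c, of D] by auto
  then show "is_digit D (tau c e z) (scale_xy c e (digit D z))"
    using is_digit_tau[OF c is_digit_digit[OF D(1)], of z] unfolding D(2) by (rule is_digit_smult)
qed

section \<open>Summability of fractions with a power of \<open>d\<close> as denominator\<close>

locale q_shift_denominator =
  fixes q :: "'a::field" and d :: "'a poly poly" and j :: nat
  assumes q: "q \<noteq> 0" "\<forall>n::nat. n > 0 \<longrightarrow> q ^ n \<noteq> 1"
    and j: "j > 0"
    and d: "irreducible d" "degree d > 0" "\<forall>c. d \<noteq> smult [:c:] [:0, 1:]"
begin

definition D :: "'a poly fract poly" where "D = fract_poly d"

definition tau_pow :: "int \<Rightarrow> int \<Rightarrow> 'a ratfun \<Rightarrow> 'a ratfun" where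
  "tau_pow i k = tau (q powi i) (q powi k)"

definition scale_pow :: "int \<Rightarrow> int \<Rightarrow> 'a poly fract poly \<Rightarrow> 'a poly fract poly" where
  "scale_pow i k = scale_xy (q powi i) (q powi k)"

text \<open>The sign expresses that \<open>\<tau>\<^sub>x\<^sup>i \<tau>\<^sub>y\<^sup>k\<close>
  maps \<open>d\<close> to its multiple by a power of \<open>q\<close>.\<close>

definition associated :: "int \<Rightarrow> int \<Rightarrow> bool" where
  "associated i k \<longleftrightarrow> (\<exists>v. shift_related q d i (- k) v)"

lemma powi_nonzero: "q powi i \<noteq> 0"
  using q(1) by simp

lemma irreducible_D: "irreducible D"
  unfolding D_def by (rule irreducible_fract_poly[OF d(1,2)])

lemma D_nonzero: "D \<noteq> 0"
  using irreducible_D by auto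

lemma degree_D: "degree D = degree d"
  by (simp add: D_def)

lemma poly_ratfun_d: "poly_ratfun d = to_fract D"
  by (simp add: poly_ratfun_def D_def)

lemma associated_dvd: "D dvd scale_pow i k D \<Longrightarrow> associated i k"
  unfolding D_def scale_pow_def associated_def by (rule shift_relatedI_dvd[OF q d(1,2)])

lemma associated_0: "associated 0 k \<Longrightarrow> k = 0"
  unfolding associated_def using shift_related_0_imp[OF q d] by force

lemma tau_pow_tau_pow: "tau_pow i k (tau_pow i' k' r) = tau_pow (i + i') (k + k') r"
  unfolding tau_pow_def by (simp add: tau_tau powi_nonzero power_int_add q(1))

lemma scale_pow_scale_pow: "scale_pow i k (scale_pow i' k' u) = scale_pow (i + i') (k + k') u"
  unfolding scale_pow_def by (simp add: scale_xy_scale_xy powi_nonzero power_int_add q(1))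

lemma tau_pow_0 [simp]: "tau_pow 0 0 r = r"
  by (simp add: tau_pow_def)

lemma scale_pow_0 [simp]: "scale_pow 0 0 u = u"
  by (simp add: scale_pow_def scale_xy_1_1)

lemmas tau_pow_hom =
  tau_add[OF powi_nonzero powi_nonzero, folded tau_pow_def]
  tau_diff[OF powi_nonzero powi_nonzero, folded tau_pow_def]
  tau_mult[OF powi_nonzero powi_nonzero, folded tau_pow_def]
  tau_power[OF powi_nonzero powi_nonzero, folded tau_pow_def]
  tau_divide[OF powi_nonzero powi_nonzero, folded tau_pow_def]

lemmas tau_pow_Fract = tau_Fract[OF powi_nonzero powi_nonzero, folded tau_pow_def scale_pow_def]
lemmas tau_pow_to_fract = tau_to_fract[OF powi_nonzero powi_nonzero, folded tau_pow_def scale_pow_def]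
lemmas scale_pow_dvd_iff = scale_xy_dvd_iff[OF powi_nonzero powi_nonzero, folded scale_pow_def]
lemmas irreducible_scale_pow = irreducible_scale_xy[OF powi_nonzero powi_nonzero, folded scale_pow_def]
lemmas scale_pow_add = scale_xy_add[OF powi_nonzero powi_nonzero, folded scale_pow_def]

lemma tau_x_eq_tau_pow: "tau_x q = tau_pow 1 0"
  using q(1) by (simp add: tau_x_eq tau_pow_def)

lemma tau_y_eq_tau_pow: "tau_y q = tau_pow 0 1"
  using q(1) by (simp add: tau_y_eq tau_pow_def)

lemma funpow_int_tau_x: "funpow_int (tau_x q) t = tau_pow t 0"
  using q(1) by (simp add: tau_x_eq funpow_int_tau tau_pow_def)

lemma funpow_int_tau_y: "funpow_int (tau_y q) t = tau_pow 0 t"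
  using q(1) by (simp add: tau_y_eq funpow_int_tau tau_pow_def)

text \<open>The numerator of \<open>1 / d\<^sup>j\<close> in the partial fraction expansion with respect to \<open>y\<close>.\<close>

definition component :: "'a ratfun \<Rightarrow> 'a poly fract poly" where
  "component g = digit D (g * to_fract D ^ j)"

lemma component_add: "component (g + h) = component g + component h"
  by (simp add: component_def irreducible_D digit_add algebra_simps)

lemma component_diff: "component (g - h) = component g - component h"
  by (simp add: component_def irreducible_D digit_diff algebra_simps)

lemma degree_component: "degree (component g) < degree D"
  by (simp add: component_def irreducible_D degree_digit)

text \<open>Since \<open>j > 0\<close>, multiplication by \<open>D ^ j\<close> moves the fraction
  into the maximal ideal at \<open>D\<close>.\<close>

lemma component_eq_0:
  assumes "\<not> D dvd B"
  shows "component (Fract A B) = 0"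
proof -
  have "Fract A B * to_fract D ^ j = to_fract (D * (D ^ (j - 1) * A)) / to_fract B"
    using j by (cases j) (simp_all add: Fract_conv_to_fract to_fract_power)
  then show ?thesis
    unfolding component_def by (simp only: digit_eq_0[OF irreducible_D assms])
qed

text \<open>A nonzero component forces a shift of \<open>D\<close> to divide the denominator of
  \<open>g\<close>. The assumption makes these shifts pairwise non-associated, so only finitely many
  of them are divisors.\<close>

lemma finite_support:
  assumes "\<And>s s'. s \<in> S \<Longrightarrow> s' \<in> S \<Longrightarrow> associated (fst s - fst s') (snd s - snd s') \<Longrightarrow> s = s'"
  shows "finite {s \<in> S. component (tau_pow (fst s) (snd s) g) \<noteq> 0}"
proof (cases g)
  case (Fract A B)
  \<comment> \<open>Instead of shifting the denominator \<open>B\<close> forward, \<open>D\<close>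
    is shifted backward, so that all divisibilities concern the same \<open>B\<close>.\<close>
  define P where "P s = scale_pow (- fst s) (- snd s) D" for s
  have P: "scale_pow (fst s) (snd s) (P s') = scale_pow (fst s - fst s') (snd s - snd s') D" for s s'
    by (simp add: P_def scale_pow_scale_pow)
  have "finite {s \<in> S. P s dvd B}"
  proof (rule finite_irreducible_divisors[OF Fract(2), where P = P])
    fix s s' assume "s \<in> {s \<in> S. P s dvd B}" "s' \<in> {s \<in> S. P s dvd B}" and "P s dvd P s'"
    from \<open>P s dvd P s'\<close> have "scale_pow (fst s) (snd s) (P s) dvd scale_pow (fst s) (snd s) (P s')"
      by (simp only: scale_pow_dvd_iff)
    then have "D dvd scale_pow (fst s - fst s') (snd s - snd s') D"
      unfolding P by simp
    with assms \<open>s \<in> _\<close> \<open>s' \<in> _\<close> show "s = s'"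
      using associated_dvd by blast
  qed (auto simp: P_def irreducible_scale_pow irreducible_D)
  moreover have "component (tau_pow (fst s) (snd s) g) = 0" if "\<not> P s dvd B" for s
  proof -
    have "\<not> scale_pow (fst s) (snd s) (P s) dvd scale_pow (fst s) (snd s) B"
      using that by (simp only: scale_pow_dvd_iff not_False_eq_True)
    then show ?thesis
      using Fract unfolding P by (simp add: tau_pow_Fract component_eq_0)
  qed
  ultimately show ?thesis
    by (elim rev_finite_subset) auto
qed

lemma finite_support_y: "finite {k. component (tau_pow i k g) \<noteq> 0}"
proof -
  have "finite {s \<in> {i} \<times> UNIV. component (tau_pow (fst s) (snd s) g) \<noteq> 0}"
    by (rule finite_support) (use associated_0 in fastforce)
  then show ?thesis
    by (rule finite_surj[where f = snd]) force
qed

section \<open>Sums over the orbits of the shift in y\<close>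

definition orbit_sum :: "'a ratfun \<Rightarrow> 'a poly fract poly" where
  "orbit_sum g = (\<Sum>k. component (tau_pow 0 k g))"

text \<open>An infinite sum would default to 0, so additivity depends on
  \<open>finite_support_y\<close>.\<close>

lemma orbit_sum_diff: "orbit_sum (g - h) = orbit_sum g - orbit_sum h"
proof -
  have "orbit_sum (g - h + h) = orbit_sum (g - h) + orbit_sum h"
    unfolding orbit_sum_def
    by (subst Sum_any.distrib[symmetric, OF finite_support_y finite_support_y])
       (simp add: tau_pow_hom component_add component_diff)
  then show ?thesis by simp
qed

lemma orbit_sum_add: "orbit_sum (g + h) = orbit_sum g + orbit_sum h"
  using orbit_sum_diff[of "g + h" h] by simp

text \<open>Translating the summation index absorbs \<open>l\<close>. Invariance under
  \<open>\<tau>\<^sub>y\<close> is the case \<open>i = 0\<close>.\<close>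

lemma orbit_sum_tau_pow: "orbit_sum (tau_pow i l g) = (\<Sum>k. component (tau_pow i k g))"
  unfolding orbit_sum_def
  by (rule Sum_any.reindex_cong[symmetric, where l = "\<lambda>k. k + l"])
     (auto simp: tau_pow_tau_pow o_def bij_iff intro!: bijI' exI[of _ "_ - l"])

lemma orbit_sum_tau_y: "orbit_sum (tau_pow 0 l g) = orbit_sum g"
  by (subst orbit_sum_tau_pow) (simp add: orbit_sum_def)

lemma degree_orbit_sum: "degree (orbit_sum g) < degree d"
  unfolding orbit_sum_def Sum_any.expand_set
  using degree_component d(2) by (intro degree_sum_less) (auto simp: degree_D)

section \<open>Shifts that stabilize the denominator\<close>

text \<open>On the support of \<open>d\<close> the exponents satisfy
  \<open>t * i - l * n = v\<close>, so \<open>D\<close> is an eigenvector of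
  \<open>T = \<tau>\<^sub>x\<^sup>t \<tau>\<^sub>y\<^sup>-\<^sup>l\<close>.\<close>

lemma scale_pow_stabilizer:
  assumes "shift_related q d t l v"
  shows "scale_pow t (- l) D = smult (to_fract [:q powi v:]) D"
proof -
  have supp: "t * int i = v + l * int n" if "coeff (coeff d n) i \<noteq> 0" for n i
    using assms that unfolding shift_related_iff_support[OF q] by blast
  have pow: "(q powi k) ^ n = q powi (k * int n)" for k n
    by (simp add: power_int_mult)
  have "scale_poly (q powi t) (q powi - l) d = smult [:q powi v:] d"
  proof (intro poly_eqI)
    fix n i
    have "(q powi - l) ^ n * (q powi t) ^ i = q powi v" if "coeff (coeff d n) i \<noteq> 0"
      using supp[OF that] q(1) unfolding pow by (simp flip: power_int_add)
    then show "coeff (coeff (scale_poly (q powi t) (q powi - l) d) n) i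
        = coeff (coeff (smult [:q powi v:] d) n) i"
      by (cases "coeff (coeff d n) i = 0") (simp_all add: coeff_scale_poly[OF powi_nonzero powi_nonzero])
  qed
  then show ?thesis
    by (simp add: D_def scale_pow_def scale_xy_fract_poly[OF powi_nonzero powi_nonzero])
qed

text \<open>The \<open>j\<close>-th power of \<open>D\<close> has eigenvalue
  \<open>q powi (v * j)\<close> under \<open>T\<close>; this is the source of the twist in the
  equation for \<open>a\<close>.\<close>

lemma denominator_stabilizer:
  assumes "shift_related q d t l v"
  shows "to_fract D ^ j = const_ratfun (q powi (- (v * int j))) * tau_pow t (- l) (to_fract D ^ j)"
proof -
  define k where "k = to_fract [:q powi (- (v * int j)):]"
  have "(q powi v) ^ j = q powi (v * int j)"
    by (simp add: power_int_mult)
  then have "q powi (- (v * int j)) * (q powi v) ^ j = 1"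
    using q(1) by (simp add: power_int_minus)
  then have k: "k * to_fract [:q powi v:] ^ j = 1"
    by (simp add: k_def poly_const_pow mult.commute flip: one_pCons to_fract_mult to_fract_power)
  have "to_fract [:k:] * tau_pow t (- l) (to_fract D ^ j)
      = to_fract ([:k:] * (smult (to_fract [:q powi v:]) D) ^ j)"
    by (simp only: tau_pow_hom(4) tau_pow_to_fract scale_pow_stabilizer[OF assms]
        to_fract_power to_fract_mult)
  also have "[:k:] * smult (to_fract [:q powi v:]) D ^ j = D ^ j"
    using k by (simp add: smult_power mult.commute)
  finally have "to_fract [:k:] * tau_pow t (- l) (to_fract D ^ j) = to_fract D ^ j"
    by (simp only: to_fract_power)
  then show ?thesis
    unfolding k_def const_ratfun_def ..
qed

lemma component_stabilizer:
  assumes "shift_related q d t l v"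
  shows "component (tau_pow t (- l) z)
    = smult (to_fract [:q powi (- (v * int j)):]) (scale_pow t (- l) (component z))"
proof -
  define k where "k = to_fract [:q powi (- (v * int j)):]"
  have "tau_pow t (- l) z * to_fract D ^ j
      = tau_pow t (- l) z * (to_fract [:k:] * tau_pow t (- l) (to_fract D ^ j))"
    using denominator_stabilizer[OF assms, unfolded const_ratfun_def, folded k_def] by (rule arg_cong)
  also have "\<dots> = to_fract [:k:] * tau_pow t (- l) (z * to_fract D ^ j)"
    by (simp only: tau_pow_hom(3) mult_ac)
  finally have "component (tau_pow t (- l) z) = smult k (digit D (tau_pow t (- l) (z * to_fract D ^ j)))"
    by (simp add: component_def digit_smult irreducible_D)
  also have "digit D (tau_pow t (- l) (z * to_fract D ^ j)) = scale_pow t (- l) (component z)"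
    unfolding component_def tau_pow_def scale_pow_def
    by (rule digit_tau[OF powi_nonzero powi_nonzero irreducible_D])
      (rule scale_pow_stabilizer[OF assms, unfolded scale_pow_def])
  finally show ?thesis unfolding k_def .
qed

text \<open>Invariance under \<open>\<tau>\<^sub>y\<close> allows
  \<open>\<tau>\<^sub>x\<^sup>t\<close> to be replaced by \<open>T\<close>, whose effect on each
  component is known.\<close>

lemma orbit_sum_stabilizer:
  assumes "shift_related q d t l v"
  shows "orbit_sum (tau_pow t 0 g)
    = smult (to_fract [:q powi (- (v * int j)):]) (scale_pow t (- l) (orbit_sum g))"
proof -
  \<comment> \<open>Restricting to the finite support lets the additive map \<open>h\<close> pass
    through the sum.\<close>
  define A where "A = {k. component (tau_pow 0 k g) \<noteq> 0}"
  define h where "h u = smult (to_fract [:q powi (- (v * int j)):]) (scale_pow t (- l) u)" for u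
  have h0: "h 0 = 0" by (simp add: h_def scale_pow_def)
  have "orbit_sum (tau_pow t 0 g) = orbit_sum (tau_pow t (- l) g)"
    by (simp add: orbit_sum_tau_pow)
  also have "\<dots> = (\<Sum>k. component (tau_pow t (- l) (tau_pow 0 k g)))"
    unfolding orbit_sum_def by (simp add: tau_pow_tau_pow add.commute)
  also have "\<dots> = (\<Sum>k. h (component (tau_pow 0 k g)))"
    by (simp add: component_stabilizer[OF assms] h_def)
  also have "\<dots> = (\<Sum>k\<in>A. h (component (tau_pow 0 k g)))"
    using finite_support_y[of 0 g] by (intro Sum_any.expand_superset) (auto simp: A_def h0)
  also have "\<dots> = h (\<Sum>k\<in>A. component (tau_pow 0 k g))"
    using sum_comp_morphism[of h "\<lambda>k. component (tau_pow 0 k g)" A] h0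
    by (simp add: o_def h_def scale_pow_add smult_add_right)
  also have "(\<Sum>k\<in>A. component (tau_pow 0 k g)) = orbit_sum g"
    unfolding orbit_sum_def A_def by (simp only: Sum_any.expand_set)
  finally show ?thesis unfolding h_def .
qed

lemma component_tau_pow_fraction:
  assumes "\<not> associated i k"
  shows "component (tau_pow i k (to_fract a / to_fract D ^ j)) = 0"
proof -
  have "\<not> D dvd scale_pow i k D ^ j"
    using assms associated_dvd prime_elem_dvd_power[OF field_poly_irreducible_imp_prime[OF irreducible_D]]
    by blast
  moreover have "tau_pow i k (to_fract a / to_fract D ^ j) = Fract (scale_pow i k a) (scale_pow i k D ^ j)"
    by (simp add: tau_pow_hom tau_pow_to_fract Fract_conv_to_fract to_fract_power)
  ultimately show ?thesis
    by (simp only: component_eq_0 not_False_eq_True)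
qed

lemma orbit_sum_shifted_fraction:
  assumes "\<And>k. \<not> associated i k"
  shows "orbit_sum (tau_pow i 0 (to_fract a / to_fract D ^ j)) = 0"
  by (simp add: orbit_sum_tau_pow component_tau_pow_fraction[OF assms])

text \<open>Different y-shifts of \<open>d\<close> are not associated, so only the summand at
  \<open>k = 0\<close> survives; there \<open>a\<close> is its own digit.\<close>

lemma orbit_sum_fraction:
  assumes "degree a < degree d"
  shows "orbit_sum (to_fract a / to_fract D ^ j) = a"
proof -
  have "component (tau_pow 0 k (to_fract a / to_fract D ^ j)) = (if k = 0 then a else 0)" for k
  proof (cases "k = 0")
    case True
    then show ?thesis
      using assms D_nonzero by (simp add: component_def digit_to_fract irreducible_D degree_D)
  next
    case False
    then have "\<not> associated 0 k"
      using associated_0 by blast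
    with False show ?thesis
      by (simp add: component_tau_pow_fraction)
  qed
  then show ?thesis by (simp add: orbit_sum_def)
qed

lemma shift_related_uminus:
  "shift_related q d t l v \<Longrightarrow> shift_related q d (- t) (- l) (- v)"
  unfolding shift_related_iff_support[OF q] by force

section \<open>Necessity by telescoping\<close>

text \<open>Invariance under \<open>\<tau>\<^sub>y\<close> annihilates the contribution of
  \<open>h\<close>.\<close>

lemma orbit_sum_telescope:
  assumes f: "f = tau_pow 1 0 g - g + (tau_pow 0 1 h - h)"
  shows "orbit_sum (tau_pow (i + 1) 0 g) = orbit_sum (tau_pow i 0 g) + orbit_sum (tau_pow i 0 f)"
proof -
  have "tau_pow i 0 f = tau_pow (i + 1) 0 g - tau_pow i 0 g
      + (tau_pow 0 1 (tau_pow i 0 h) - tau_pow i 0 h)"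
    by (simp add: f tau_pow_hom tau_pow_tau_pow)
  then show ?thesis
    by (simp add: orbit_sum_add orbit_sum_diff orbit_sum_tau_y)
qed

text \<open>Without relations for nonzero \<open>t\<close>, all shifts of \<open>d\<close> in both
  variables are pairwise non-associated. Hence only finitely many pairs have a nonzero component,
  and these project onto the indices in question.\<close>

lemma finite_orbit_sum_support:
  assumes "\<And>t l v. shift_related q d t l v \<Longrightarrow> t = 0"
  shows "finite {i. orbit_sum (tau_pow i 0 g) \<noteq> 0}"
proof -
  have "s = s'" if "associated (fst s - fst s') (snd s - snd s')" for s s'
  proof -
    from that assms have "fst s - fst s' = 0"
      unfolding associated_def by blast
    moreover from this that have "snd s - snd s' = 0"
      by (intro associated_0) simp
    ultimately show ?thesis by (simp add: prod_eq_iff)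
  qed
  then have fin: "finite {s \<in> UNIV. component (tau_pow (fst s) (snd s) g) \<noteq> 0}"
    by (rule finite_support)
  have "\<exists>k. component (tau_pow i k g) \<noteq> 0" if "orbit_sum (tau_pow i 0 g) \<noteq> 0" for i
    using that by (auto simp: orbit_sum_tau_pow elim: Sum_any.not_neutral_obtains_not_neutral)
  then have "{i. orbit_sum (tau_pow i 0 g) \<noteq> 0}
      \<subseteq> fst ` {s \<in> UNIV. component (tau_pow (fst s) (snd s) g) \<noteq> 0}"
    by (force simp: image_iff)
  then show ?thesis
    using fin finite_surj by blast
qed

lemma summable_imp_related:
  assumes a: "a \<noteq> 0" "degree a < degree d"
    and f: "to_fract a / to_fract D ^ j = tau_pow 1 0 g - g + (tau_pow 0 1 h - h)"
  shows "\<exists>t l v. t \<noteq> 0 \<and> shift_related q d t l v"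
proof (rule ccontr)
  assume "\<nexists>t l v. t \<noteq> 0 \<and> shift_related q d t l v"
  then have rel: "t = 0" if "shift_related q d t l v" for t l v
    using that by blast
  define u where "u i = orbit_sum (tau_pow i 0 g)" for i
  have step: "u (i + 1) = u i" if "i \<noteq> 0" for i
    using orbit_sum_telescope[OF f, of i] orbit_sum_shifted_fraction[of i a] rel that
    unfolding u_def associated_def by force
  have "u 1 = u 0 + a"
    using orbit_sum_telescope[OF f, of 0] orbit_sum_fraction[OF a(2)] by (simp add: u_def)
  have up: "u (1 + int n) = u 1" for n
    using step[of "1 + int n" for n] by (induction n) (simp_all add: add.commute add.left_commute)
  have down: "u (- int n) = u 0" for n
  proof (induction n)
    case (Suc n)
    then show ?case using step[of "- int (Suc n)"] by simp
  qed simp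
  have fin: "finite {i. u i \<noteq> 0}"
    unfolding u_def using rel by (rule finite_orbit_sum_support)
  \<comment> \<open>A nonzero constant value on a half-line would contradict the finite support of
    \<open>u\<close>; the same argument applies to \<open>u 0\<close>.\<close>
  have "u 1 = 0"
  proof (rule ccontr)
    assume "u 1 \<noteq> 0"
    then have "(\<lambda>n. 1 + int n) ` UNIV \<subseteq> {i. u i \<noteq> 0}" by (auto simp: up)
    from finite_subset[OF this fin] show False
      by (auto dest!: finite_imageD simp: inj_on_def)
  qed
  moreover have "u 0 = 0"
  proof (rule ccontr)
    assume "u 0 \<noteq> 0"
    then have "(\<lambda>n. - int n) ` UNIV \<subseteq> {i. u i \<noteq> 0}" by (auto simp: down)
    from finite_subset[OF this fin] show False
      by (auto dest!: finite_imageD simp: inj_on_def)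
  qed
  ultimately show False using \<open>u 1 = u 0 + a\<close> a(1) by simp
qed

lemma summable_imp_equation:
  assumes a: "degree a < degree d"
    and f: "to_fract a / to_fract D ^ j = tau_pow 1 0 g - g + (tau_pow 0 1 h - h)"
    and t: "0 < t" "shift_related q d t l v"
    and minimal: "\<And>t' l' v'. 0 < t' \<Longrightarrow> shift_related q d t' l' v' \<Longrightarrow> t \<le> t'"
  shows "a = smult (to_fract [:q powi (- (v * int j)):]) (scale_pow t (- l) (orbit_sum g)) - orbit_sum g"
proof -
  define u where "u i = orbit_sum (tau_pow i 0 g)" for i
  have "u 1 = u 0 + a"
    using orbit_sum_telescope[OF f, of 0] orbit_sum_fraction[OF a] by (simp add: u_def)
  \<comment> \<open>Minimality of \<open>t\<close> excludes any association at indices strictly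
    between 0 and \<open>t\<close>.\<close>
  have step: "u (i + 1) = u i" if "0 < i" "i < t" for i
  proof -
    have "\<not> associated i k" for k
      using minimal[OF that(1)] that(2) unfolding associated_def by force
    then show ?thesis
      using orbit_sum_telescope[OF f, of i] orbit_sum_shifted_fraction[of i a] by (simp add: u_def)
  qed
  have "u (1 + int n) = u 0 + a" if "1 + int n \<le> t" for n
    using that
  proof (induction n)
    case (Suc n)
    then show ?case using step[of "1 + int n"] by (simp add: add_ac)
  qed (simp add: \<open>u 1 = u 0 + a\<close>)
  from this[of "nat (t - 1)"] t(1) have "u t = u 0 + a" by simp
  then show ?thesis
    using orbit_sum_stabilizer[OF t(2), of g] by (simp add: u_def)
qed

section \<open>Sufficiency of the equation\<close>

text \<open>For \<open>i > 0\<close> the witness is the sum of the first \<open>i\<close> iterates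
  of \<open>f\<close> under \<open>tau_pow x y\<close>, starting from \<open>f\<close> itself. For
  negative \<open>i\<close> it is minus the sum of the iterates from \<open>i\<close> to -1.\<close>

lemma tau_pow_multiple_telescope: "\<exists>g. tau_pow (i * x) (i * y) f - f = tau_pow x y g - g"
proof (induction i rule: int_induct[where k = 0])
  case base
  show ?case by (intro exI[of _ 0]) (simp add: tau_pow_def tau_0[OF powi_nonzero powi_nonzero])
next
  case (step1 i)
  then obtain g where g: "tau_pow (i * x) (i * y) f - f = tau_pow x y g - g" by blast
  define u where "u = tau_pow (i * x) (i * y) f"
  have "tau_pow x y u = tau_pow ((i + 1) * x) ((i + 1) * y) f"
    by (simp add: u_def tau_pow_tau_pow algebra_simps)
  then have "tau_pow ((i + 1) * x) ((i + 1) * y) f - f = tau_pow x y u - u + (u - f)"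
    by simp
  also have "u - f = tau_pow x y g - g"
    using g by (simp only: u_def)
  also have "tau_pow x y u - u + (tau_pow x y g - g) = tau_pow x y (u + g) - (u + g)"
    by (simp add: tau_pow_hom(1))
  finally show ?case by (rule exI)
next
  case (step2 i)
  then obtain g where g: "tau_pow (i * x) (i * y) f - f = tau_pow x y g - g" by blast
  define u where "u = tau_pow ((i - 1) * x) ((i - 1) * y) f"
  have u: "tau_pow x y u = tau_pow (i * x) (i * y) f"
    by (simp add: u_def tau_pow_tau_pow algebra_simps)
  have "u - f = tau_pow x y u - f - (tau_pow x y u - u)"
    by simp
  also have "tau_pow x y u - f = tau_pow x y g - g"
    using g by (simp only: u)
  also have "tau_pow x y g - g - (tau_pow x y u - u) = tau_pow x y (g - u) - (g - u)"
    by (simp add: tau_pow_hom(2))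
  finally show ?case unfolding u_def by (rule exI)
qed

text \<open>Inserting \<open>tau_pow 0 l f\<close> as an intermediate term separates a difference in
  x from one in y, and each of them telescopes.\<close>

lemma tau_summable_tau_pow_diff: "tau_summable q (tau_pow t l f - f)"
proof -
  obtain g where g: "tau_pow t 0 (tau_pow 0 l f) - tau_pow 0 l f = tau_pow 1 0 g - g"
    using tau_pow_multiple_telescope[of t 1 0] by auto
  obtain h where h: "tau_pow 0 l f - f = tau_pow 0 1 h - h"
    using tau_pow_multiple_telescope[of l 0 1] by auto
  have "tau_pow t l f - f = tau_pow 1 0 g - g + (tau_pow 0 1 h - h)"
    unfolding g[symmetric] h[symmetric] by (simp add: tau_pow_tau_pow)
  then show ?thesis
    unfolding tau_summable_def tau_x_eq_tau_pow tau_y_eq_tau_pow by blast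
qed

text \<open>Division by \<open>D ^ j\<close> absorbs the twist, which turns the equation for
  \<open>a\<close> into an untwisted difference under \<open>T\<close>.\<close>

lemma equation_imp_summable:
  assumes rel: "shift_related q d t l v"
    and a: "to_fract a = const_ratfun (q powi (- (v * int j))) * tau_pow t (- l) (to_fract p) - to_fract p"
  shows "tau_summable q (to_fract a / to_fract D ^ j)"
proof -
  define k :: "'a ratfun" where "k = const_ratfun (q powi (- (v * int j)))"
  define w where "w = to_fract D ^ j"
  have w: "w = k * tau_pow t (- l) w"
    unfolding w_def k_def by (rule denominator_stabilizer[OF rel])
  have "w \<noteq> 0"
    by (simp add: w_def D_nonzero)
  then have "k \<noteq> 0" "tau_pow t (- l) w \<noteq> 0"
    using w by auto
  then have "k * tau_pow t (- l) (to_fract p) / w = tau_pow t (- l) (to_fract p / w)"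
    by (subst w) (simp add: tau_pow_hom)
  then have "to_fract a / w = tau_pow t (- l) (to_fract p / w) - to_fract p / w"
    by (simp add: a diff_divide_distrib flip: k_def)
  then show ?thesis
    using tau_summable_tau_pow_diff unfolding w_def by metis
qed

text \<open>Relations are closed under negation, so a positive \<open>t\<close> occurs, and the
  well-ordering of the naturals gives a least one.\<close>

lemma minimal_shift_exists:
  assumes "t \<noteq> 0" "shift_related q d t l v"
  shows "\<exists>t' l' v'. 0 < t' \<and> shift_related q d t' l' v' \<and>
    (\<forall>t'' l'' v''. 0 < t'' \<and> shift_related q d t'' l'' v'' \<longrightarrow> t' \<le> t'')"
proof -
  define P where "P n \<longleftrightarrow> 0 < n \<and> (\<exists>l v. shift_related q d (int n) l v)" for n
  have "P (nat \<bar>t\<bar>)"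
    using assms shift_related_uminus[OF assms(2)] by (cases "t > 0") (auto simp: P_def)
  then have "P (Least P)" and le: "P n \<Longrightarrow> Least P \<le> n" for n
    by (auto intro: LeastI Least_le)
  from \<open>P (Least P)\<close> obtain l' v' where "0 < int (Least P)" "shift_related q d (int (Least P)) l' v'"
    unfolding P_def of_nat_0_less_iff by blast
  moreover have "int (Least P) \<le> t''" if "0 < t''" "shift_related q d t'' l'' v''" for t'' l'' v''
  proof -
    from that have "P (nat t'')" by (auto simp: P_def)
    from le[OF this] that(1) show ?thesis by linarith
  qed
  ultimately show ?thesis
    by blast
qed

lemma summable_iff:
  assumes a: "a \<noteq> 0" "degree a < degree d"
  shows "tau_summable q (to_fract a / poly_ratfun d ^ j) \<longleftrightarrow>
    (\<exists>t l v. t \<noteq> 0 \<and> shift_related q d t l v) \<and>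
    (\<forall>t l v. 0 < t \<and> shift_related q d t l v \<and>
       (\<forall>t' l' v'. 0 < t' \<and> shift_related q d t' l' v' \<longrightarrow> t \<le> t') \<longrightarrow>
       (\<exists>p. degree p < degree d \<and>
          to_fract a = const_ratfun (q powi (- (v * int j)))
              * funpow_int (tau_x q) t (funpow_int (tau_y q) (- l) (to_fract p)) - to_fract p))"
    (is "?S \<longleftrightarrow> ?R \<and> ?E")
proof
  assume ?S
  then obtain g h where f: "to_fract a / to_fract D ^ j = tau_pow 1 0 g - g + (tau_pow 0 1 h - h)"
    unfolding tau_summable_def tau_x_eq_tau_pow tau_y_eq_tau_pow poly_ratfun_d by blast
  have ?E
  proof (intro allI impI, elim conjE)
    fix t l v
    assume t: "0 < t" "shift_related q d t l v"
      "\<forall>t' l' v'. 0 < t' \<and> shift_related q d t' l' v' \<longrightarrow> t \<le> t'"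
    have minimal: "t \<le> t'" if "0 < t'" "shift_related q d t' l' v'" for t' l' v'
      using t(3) that by blast
    have "to_fract a = to_fract (smult (to_fract [:q powi (- (v * int j)):])
        (scale_pow t (- l) (orbit_sum g)) - orbit_sum g)"
      using summable_imp_equation[OF a(2) f t(1,2) minimal] by (simp only:)
    also have "\<dots> = const_ratfun (q powi (- (v * int j)))
        * tau_pow t (- l) (to_fract (orbit_sum g)) - to_fract (orbit_sum g)"
      by (simp add: const_ratfun_def tau_pow_to_fract flip: to_fract_mult)
    \<comment> \<open>The witness \<open>orbit_sum g\<close> is the same for every choice of
      \<open>l\<close> and \<open>v\<close>.\<close>
    finally show "\<exists>p. degree p < degree d \<and>
          to_fract a = const_ratfun (q powi (- (v * int j)))
              * funpow_int (tau_x q) t (funpow_int (tau_y q) (- l) (to_fract p)) - to_fract p"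
      using degree_orbit_sum
      by (intro exI[of _ "orbit_sum g"]) (simp add: funpow_int_tau_x funpow_int_tau_y tau_pow_tau_pow)
  qed
  with summable_imp_related[OF a f] show "?R \<and> ?E" by blast
next
  assume *: "?R \<and> ?E"
  then obtain t0 l0 v0 where "t0 \<noteq> 0" "shift_related q d t0 l0 v0" by blast
  \<comment> \<open>The second condition quantifies universally over minimal relations; the first
    one ensures that this is not vacuous.\<close>
  from minimal_shift_exists[OF this] obtain t l v where t: "0 < t" "shift_related q d t l v"
    and minimal: "\<forall>t' l' v'. 0 < t' \<and> shift_related q d t' l' v' \<longrightarrow> t \<le> t'"
    by (elim exE conjE)
  have "\<exists>p. degree p < degree d \<and>
      to_fract a = const_ratfun (q powi (- (v * int j)))
          * funpow_int (tau_x q) t (funpow_int (tau_y q) (- l) (to_fract p)) - to_fract p"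
    using conjunct2[OF *] by (elim allE[of _ t] allE[of _ l] allE[of _ v]) (use t minimal in simp)
  then obtain p where "to_fract a = const_ratfun (q powi (- (v * int j)))
      * tau_pow t (- l) (to_fract p) - to_fract p"
    by (auto simp: funpow_int_tau_x funpow_int_tau_y tau_pow_tau_pow)
  from equation_imp_summable[OF t(2) this] show ?S
    by (simp only: poly_ratfun_d)
qed

end

theorem theorem3p8:
  fixes q :: "'a::field_char_0" and j :: nat
    and d :: "'a poly poly" and a :: "'a poly fract poly"
  assumes "q \<noteq> 0" and "\<forall>n::nat. n > 0 \<longrightarrow> q ^ n \<noteq> 1"
    and "j > 0"
    and "irreducible d" and "\<forall>c. d \<noteq> smult [:c:] [:0, 1:]"
    and "a \<noteq> 0" and "degree a < degree d"
  shows "tau_summable q (to_fract a / poly_ratfun d ^ j) \<longleftrightarrow>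
    (\<exists>t l v :: int. t \<noteq> 0 \<and> shift_related q d t l v) \<and>
    (\<forall>t l v :: int.
       0 < t \<and> shift_related q d t l v \<and>
       (\<forall>t' l' v' :: int. 0 < t' \<and> shift_related q d t' l' v' \<longrightarrow> t \<le> t') \<longrightarrow>
       (\<exists>p :: 'a poly fract poly. degree p < degree d \<and>
          to_fract a =
            const_ratfun (q powi (- (v * int j)))
              * funpow_int (tau_x q) t (funpow_int (tau_y q) (- l) (to_fract p))
            - to_fract p))"
proof -
  \<comment> \<open>Positivity of \<open>degree d\<close> comes from
    \<open>degree a < degree d\<close>.\<close>
  interpret q_shift_denominator q d j
    using assms by unfold_locales auto
  show ?thesis
    by (rule summable_iff) (use assms in auto)
qed

end
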